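(* Let $m\ge 2$, let $(\mathcal W\cup\mathcal W',\mathcal Y\cup\mathcal Y')$ be an $m$-triangular labyrinth patterns system, and suppose that $\mathcal W'$ and $\mathcal Y'$ are non-empty. Then the sets $L^{w}_\infty$ and $L^{y}_\infty$ have a graph-directed structure and satisfy $$L^{w}_\infty=\bigcup_{\Delta\in\mathcal W}P_\Delta(L^{w}_\infty)\cup\bigcup_{\Delta'\in\mathcal W'}P_{\Delta'}(L^{y}_\infty),\qquad L^{y}_\infty=\bigcup_{\Delta\in\mathcal Y}P_\Delta(L^{y}_\infty)\cup\bigcup_{\Delta'\in\mathcal Y'}P_{\Delta'}(L^{w}_\infty).$$ The Hausdorff dimension and the box-counting dimension of the two fractals coincide and are given by $$\dim_H(L^{w}_\infty)=\dim_H(L^{y}_\infty)=\dim_B(L^{w}_\infty)=\dim_B(L^{y}_\infty)=\frac{\log\lambda}{\log m},$$ where $$\lambda=\frac{|\mathcal W|+|\mathcal Y|+\sqrt{(|\mathcal W|-|\mathcal Y|)^2+4|\mathcal W'||\mathcal Y'|}}{2}.$$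
   Context: **Triangles.** Let $H=\{(\alpha_1,\alpha_2,\alpha_3)\in[0,1]^3:\alpha_1+\alpha_2+\alpha_3=1\}$, $\mathbb N=\{0,1,2,\dots\}$, $\mathbf P_1=(0,0)$, $\mathbf P_2=(1,0)$, $\mathbf P_3=(1/2,\sqrt3/2)$. $\Delta(\mathbf A_1,\mathbf A_2,\mathbf A_3)$ denotes the full closed triangle with (ordered) vertices $\mathbf A_1,\mathbf A_2,\mathbf A_3$, and $T_1=\Delta(\mathbf P_1,\mathbf P_2,\mathbf P_3)$. For $\Delta=\Delta(\mathbf A_1,\mathbf A_2,\mathbf A_3)\subset T_1$ let $P_\Delta:T_1\to T_1$, $\sum\alpha_i\mathbf P_i\mapsto\sum\alpha_i\mathbf A_i$ for $(\alpha_1,\alpha_2,\alpha_3)\in H$. For $m\ge2$ and $(k_1,k_2,k_3)\in\mathbb Z^3$, $T_m(k_1,k_2,k_3)$ is the triangle with ordered vertices $\mathbf A_i=\frac1m\big(k_1\mathbf P_1+k_2\mathbf P_2+k_3\mathbf P_3+\mathbf P_i\big)$ and $T'_m(k_1,k_2,k_3)$ is the triangle with ordered vertices $\mathbf A_i=\frac1m\big(k_1\mathbf P_1+k_2\mathbf P_2+k_3\mathbf P_3+\mathbf P_1+\mathbf P_2+\mathbf P_3-\mathbf P_i\big)$, $i=1,2,3$. Put $\mathcal T_m=\{T_m(k_1,k_2,k_3):k_i\in\mathbb N,\ k_1+k_2+k_3=m-1\}$ and $\mathcal T'_m=\{T'_m(k_1,k_2,k_3):k_i\in\mathbb N,\ k_1+k_2+k_3=m-2\}$.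 $T_m(k_1,k_2,k_3)$ and $T'_m(k'_1,k'_2,k'_3)$ are $j$-neighbours if $k_j=k'_j+1$ and $k_i=k'_i$ for $i\ne j$ (they then share a side). **Patterns systems.** An $m$-triangular patterns system is a pair $(\mathcal W\cup\mathcal W',\mathcal Y\cup\mathcal Y')$ with $\mathcal W,\mathcal Y\subset\mathcal T_m$ and $\mathcal W',\mathcal Y'\subset\mathcal T'_m$. Put $\mathcal W_1=\mathcal W$, $\mathcal W'_1=\mathcal W'$, $\mathcal Y_1=\mathcal Y$, $\mathcal Y'_1=\mathcal Y'$, and for $n\ge2$ $\mathcal W_n=\{P_{U}(V):U\in\mathcal W_{n-1},V\in\mathcal W_1\}\cup\{P_{U}(V):U\in\mathcal W'_{n-1},V\in\mathcal Y'_1\}$, $\mathcal W'_n=\{P_{U}(V):U\in\mathcal W_{n-1},V\in\mathcal W'_1\}\cup\{P_{U}(V):U\in\mathcal W'_{n-1},V\in\mathcal Y_1\}$, $\mathcal Y_n=\{P_{U}(V):U\in\mathcal Y_{n-1},V\in\mathcal Y_1\}\cup\{P_{U}(V):U\in\mathcal Y'_{n-1},V\in\mathcal W'_1\}$, $\mathcal Y'_n=\{P_{U}(V):U\in\mathcal Y_{n-1},V\in\mathcal Y'_1\}\cup\{P_{U}(V):U\in\mathcal Y'_{n-1},V\in\mathcal W_1\}$. $\mathcal G(\mathcal W\cup\mathcal W')$ is the undirected graph with vertex set $\mathcal W\cup\mathcal W'$ in which two vertices are joined by an edge labelled $j$ iff they are $j$-neighbours; $\mathcal G(\mathcal Y\cup\mathcal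 Y')$ is defined analogously. **Labyrinth patterns systems.** The system is an $m$-triangular labyrinth patterns system if: (1) (tree property) $\mathcal G(\mathcal W\cup\mathcal W')$ and $\mathcal G(\mathcal Y\cup\mathcal Y')$ are trees; (2) (exits property) there is exactly one triple $(k_1,k_2,k_3)$ of integers in $\{0,\dots,m-1\}$ with $T_m(0,k_1,m-1-k_1)\in\mathcal W$, $T_m(0,m-1-k_1,k_1)\in\mathcal Y$, $T_m(k_2,0,m-1-k_2)\in\mathcal W$, $T_m(m-1-k_2,0,k_2)\in\mathcal Y$, $T_m(k_3,m-1-k_3,0)\in\mathcal W$, $T_m(m-1-k_3,k_3,0)\in\mathcal Y$; (3) (corners property) the sets $\mathcal C(\mathcal W)$, $\mathcal C(\mathcal Y)$ of elements of $\mathcal W$, resp. $\mathcal Y$, that contain one of $\mathbf P_1,\mathbf P_2,\mathbf P_3$ are disjoint and each has at most one element. **Fractals.** $L^{w}_n$ (resp. $L^{y}_n$) is the union of all triangles in $\mathcal W_n\cup\mathcal W'_n$ (resp. $\mathcal Y_n\cup\mathcal Y'_n$). The white and yellow triangular labyrinth fractals are $L^{w}_\infty=\bigcap_{n\ge1}L^{w}_n$ and $L^{y}_\infty=\bigcap_{n\ge1}L^{y}_n$. **Graph-directed structure** is meant in the sense of Mauldin and Williams: $L^w_\infty,L^y_\infty$ are the invariant sets of the graph directed iterated function system on the directed multigraph with two vertices $\Omega$ (for $L^w_\infty$) and $\Gamma$ (for $L^y_\infty$), having an edge $\Omega\to\Omega$ for each element of $\mathcal W$, $\Omega\to\Gamma$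 for each element of $\mathcal W'$, $\Gamma\to\Gamma$ for each element of $\mathcal Y$, $\Gamma\to\Omega$ for each element of $\mathcal Y'$, where the edge given by a triangle $\Delta$ carries the similarity $P_\Delta$. *)

theory Defs
  imports "HOL-Analysis.Analysis" "Graph_Theory.Digraph_Component"
begin

section \<open>Triangles\<close>

type_synonym point = "real ^ 2"

text \<open>A triangle is the ordered triple of its vertices; \<open>region\<close> is the closed set it covers.\<close>

datatype triangle = Tri point point point

fun region :: "triangle \<Rightarrow> point set" where
  "region (Tri A1 A2 A3) = convex hull {A1, A2, A3}"

definition P1 :: point where "P1 = vector [0, 0]"
definition P2 :: point where "P2 = vector [1, 0]"
definition P3 :: point where "P3 = vector [1 / 2, sqrt 3 / 2]"

definition T1 :: triangle where "T1 = Tri P1 P2 P3"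

definition H :: "(real \<times> real \<times> real) set" where
  "H = {(a1, a2, a3). a1 \<in> {0..1} \<and> a2 \<in> {0..1} \<and> a3 \<in> {0..1} \<and> a1 + a2 + a3 = 1}"

fun bary :: "triangle \<Rightarrow> real \<times> real \<times> real \<Rightarrow> point" where
  "bary (Tri A1 A2 A3) (a1, a2, a3) = a1 *\<^sub>R A1 + a2 *\<^sub>R A2 + a3 *\<^sub>R A3"

text \<open>\<open>tri_map D\<close> is the map $P_\Delta$. It is specified on \<open>region T1\<close> only, where barycentric
  coordinates in \<open>H\<close> exist and are unique.\<close>

definition tri_map :: "triangle \<Rightarrow> point \<Rightarrow> point" where
  "tri_map D x = (THE y. \<exists>a\<in>H. x = bary T1 a \<and> y = bary D a)"

text \<open>\<open>tri_image U V\<close> is $P_U(V)$ as a triangle with ordered vertices.\<close>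

fun tri_image :: "triangle \<Rightarrow> triangle \<Rightarrow> triangle" where
  "tri_image U (Tri A1 A2 A3) = Tri (tri_map U A1) (tri_map U A2) (tri_map U A3)"

text \<open>\<open>tri_up m k1 k2 k3\<close> and \<open>tri_down m k1 k2 k3\<close> are $T_m(k_1,k_2,k_3)$ and
  $T'_m(k_1,k_2,k_3)$.\<close>

definition tri_up :: "nat \<Rightarrow> int \<Rightarrow> int \<Rightarrow> int \<Rightarrow> triangle" where
  "tri_up m k1 k2 k3 =
    (let Q = of_int k1 *\<^sub>R P1 + of_int k2 *\<^sub>R P2 + of_int k3 *\<^sub>R P3
     in Tri ((1 / real m) *\<^sub>R (Q + P1)) ((1 / real m) *\<^sub>R (Q + P2)) ((1 / real m) *\<^sub>R (Q + P3)))"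

definition tri_down :: "nat \<Rightarrow> int \<Rightarrow> int \<Rightarrow> int \<Rightarrow> triangle" where
  "tri_down m k1 k2 k3 =
    (let Q = of_int k1 *\<^sub>R P1 + of_int k2 *\<^sub>R P2 + of_int k3 *\<^sub>R P3 + P1 + P2 + P3
     in Tri ((1 / real m) *\<^sub>R (Q - P1)) ((1 / real m) *\<^sub>R (Q - P2)) ((1 / real m) *\<^sub>R (Q - P3)))"

definition tri_ups :: "nat \<Rightarrow> triangle set" where
  "tri_ups m = {tri_up m k1 k2 k3 | k1 k2 k3.
     0 \<le> k1 \<and> 0 \<le> k2 \<and> 0 \<le> k3 \<and> k1 + k2 + k3 = int m - 1}"

definition tri_downs :: "nat \<Rightarrow> triangle set" where
  "tri_downs m = {tri_down m k1 k2 k3 | k1 k2 k3.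
     0 \<le> k1 \<and> 0 \<le> k2 \<and> 0 \<le> k3 \<and> k1 + k2 + k3 = int m - 2}"

text \<open>The constraints on the sums are essential: since \<open>P1\<close> is the origin, the triangle alone
  determines its indices only when their sum is prescribed.\<close>

definition neighbours :: "nat \<Rightarrow> nat \<Rightarrow> triangle \<Rightarrow> triangle \<Rightarrow> bool" where
  "neighbours m j D D' \<longleftrightarrow>
    (\<exists>k1 k2 k3 l1 l2 l3.
       D = tri_up m k1 k2 k3 \<and> 0 \<le> k1 \<and> 0 \<le> k2 \<and> 0 \<le> k3 \<and> k1 + k2 + k3 = int m - 1 \<and>
       D' = tri_down m l1 l2 l3 \<and> 0 \<le> l1 \<and> 0 \<le> l2 \<and> 0 \<le> l3 \<and> l1 + l2 + l3 = int m - 2 \<and>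
       (j = 1 \<and> k1 = l1 + 1 \<and> k2 = l2 \<and> k3 = l3 \<or>
        j = 2 \<and> k1 = l1 \<and> k2 = l2 + 1 \<and> k3 = l3 \<or>
        j = 3 \<and> k1 = l1 \<and> k2 = l2 \<and> k3 = l3 + 1))"

section \<open>Labyrinth patterns systems\<close>

text \<open>The undirected labelled graph $\mathcal{G}$ on a set of triangles, represented as a symmetric
  digraph: an edge labelled \<open>j\<close> between \<open>U\<close> and \<open>V\<close> is the pair of arcs
  \<open>(U, j, V)\<close> and \<open>(V, j, U)\<close>.\<close>

definition neighbour_graph ::
    "nat \<Rightarrow> triangle set \<Rightarrow> (triangle, triangle \<times> nat \<times> triangle) pre_digraph" where
  "neighbour_graph m S =
    \<lparr>verts = S,
     arcs = {(U, j, V). U \<in> S \<and> V \<in> S \<and> (neighbours m j U V \<or> neighbours m j V U)},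
     tail = fst, head = snd \<circ> snd\<rparr>"

text \<open>Trees among undirected simple graphs represented as symmetric digraphs. The library's
  \<open>tree\<close> is not usable here: in a symmetric digraph each edge yields the closed directed
  walk \<open>u, v, u\<close>, which counts as a \<open>cycle\<close>. The cycles of the undirected graph
  are those of length at least 3. (Two triangles are \<open>j\<close>-neighbours for at most one
  \<open>j\<close>, so the graphs above are simple.)\<close>

definition undirected_tree :: "('a, 'b) pre_digraph \<Rightarrow> bool" where
  "undirected_tree G \<longleftrightarrow>
     strongly_connected G \<and> \<not> (\<exists>p. pre_digraph.cycle G p \<and> length p \<ge> 3)"

definition patterns_system ::
    "nat \<Rightarrow> triangle set \<Rightarrow> triangle set \<Rightarrow> triangle set \<Rightarrow> triangle set \<Rightarrow> bool" where
  "patterns_system m W W' Y Y' \<longleftrightarrow>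
     W \<subseteq> tri_ups m \<and> Y \<subseteq> tri_ups m \<and> W' \<subseteq> tri_downs m \<and> Y' \<subseteq> tri_downs m"

definition tree_property ::
    "nat \<Rightarrow> triangle set \<Rightarrow> triangle set \<Rightarrow> triangle set \<Rightarrow> triangle set \<Rightarrow> bool" where
  "tree_property m W W' Y Y' \<longleftrightarrow>
     undirected_tree (neighbour_graph m (W \<union> W')) \<and>
     undirected_tree (neighbour_graph m (Y \<union> Y'))"

definition exits_property :: "nat \<Rightarrow> triangle set \<Rightarrow> triangle set \<Rightarrow> bool" where
  "exits_property m W Y \<longleftrightarrow>
    (\<exists>!k. case k of (k1, k2, k3) \<Rightarrow>
       k1 \<in> {0..int m - 1} \<and> k2 \<in> {0..int m - 1} \<and> k3 \<in> {0..int m - 1} \<and>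
       tri_up m 0 k1 (int m - 1 - k1) \<in> W \<and> tri_up m 0 (int m - 1 - k1) k1 \<in> Y \<and>
       tri_up m k2 0 (int m - 1 - k2) \<in> W \<and> tri_up m (int m - 1 - k2) 0 k2 \<in> Y \<and>
       tri_up m k3 (int m - 1 - k3) 0 \<in> W \<and> tri_up m (int m - 1 - k3) k3 0 \<in> Y)"

definition corner_triangles :: "triangle set \<Rightarrow> triangle set" where
  "corner_triangles S = {D \<in> S. P1 \<in> region D \<or> P2 \<in> region D \<or> P3 \<in> region D}"

definition corners_property :: "triangle set \<Rightarrow> triangle set \<Rightarrow> bool" where
  "corners_property W Y \<longleftrightarrow>
     corner_triangles W \<inter> corner_triangles Y = {} \<and>
     (\<forall>S\<in>{W, Y}. finite (corner_triangles S) \<and> card (corner_triangles S) \<le> 1)"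

definition labyrinth_patterns_system ::
    "nat \<Rightarrow> triangle set \<Rightarrow> triangle set \<Rightarrow> triangle set \<Rightarrow> triangle set \<Rightarrow> bool" where
  "labyrinth_patterns_system m W W' Y Y' \<longleftrightarrow>
     patterns_system m W W' Y Y' \<and> tree_property m W W' Y Y' \<and>
     exits_property m W Y \<and> corners_property W Y"

section \<open>Labyrinth fractals\<close>

definition tri_images :: "triangle set \<Rightarrow> triangle set \<Rightarrow> triangle set" where
  "tri_images A B = {tri_image U V | U V. U \<in> A \<and> V \<in> B}"

context
  fixes W W' Y Y' :: "triangle set"
begin

text \<open>$\mathcal{W}_n$, $\mathcal{W}'_n$, $\mathcal{Y}_n$, $\mathcal{Y}'_n$ for $n \ge 1$; the value
  at 0 is never used.\<close>

fun white_up white_down yellow_up yellow_down :: "nat \<Rightarrow> triangle set" where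
  "white_up 0 = {}"
| "white_up (Suc 0) = W"
| "white_up (Suc (Suc n)) = tri_images (white_up (Suc n)) W \<union> tri_images (white_down (Suc n)) Y'"
| "white_down 0 = {}"
| "white_down (Suc 0) = W'"
| "white_down (Suc (Suc n)) = tri_images (white_up (Suc n)) W' \<union> tri_images (white_down (Suc n)) Y"
| "yellow_up 0 = {}"
| "yellow_up (Suc 0) = Y"
| "yellow_up (Suc (Suc n)) = tri_images (yellow_up (Suc n)) Y \<union> tri_images (yellow_down (Suc n)) W'"
| "yellow_down 0 = {}"
| "yellow_down (Suc 0) = Y'"
| "yellow_down (Suc (Suc n)) = tri_images (yellow_up (Suc n)) Y' \<union> tri_images (yellow_down (Suc n)) W"

definition white_fractal :: "point set" where
  "white_fractal = (\<Inter>n\<in>{1..}. \<Union>D \<in> white_up n \<union> white_down n. region D)"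

definition yellow_fractal :: "point set" where
  "yellow_fractal = (\<Inter>n\<in>{1..}. \<Union>D \<in> yellow_up n \<union> yellow_down n. region D)"

end

section \<open>Graph-directed iterated function systems\<close>

text \<open>Graph-directed constructions in the sense of Mauldin and Williams: a finite directed
  multigraph, a seed set \<open>J v\<close> at every vertex, and for every arc \<open>e\<close> a contracting
  similarity mapping the seed set at the head of \<open>e\<close> into the one at its tail, such that
  the images along the arcs leaving a vertex do not overlap. The seed sets at different vertices
  are thought of as lying in different copies of the space, so they may coincide.\<close>

definition graph_directed_ifs ::
    "('v, 'e) pre_digraph \<Rightarrow> ('v \<Rightarrow> 'a::euclidean_space set) \<Rightarrow> ('e \<Rightarrow> 'a \<Rightarrow> 'a) \<Rightarrow> bool" where
  "graph_directed_ifs G J f \<longleftrightarrow>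
     fin_digraph G \<and>
     (\<forall>v\<in>verts G. compact (J v) \<and> interior (J v) \<noteq> {}) \<and>
     (\<forall>v\<in>verts G. out_arcs G v \<noteq> {}) \<and>
     (\<forall>e\<in>arcs G. f e ` J (head G e) \<subseteq> J (tail G e) \<and>
        (\<exists>r. 0 < r \<and> r < 1 \<and>
           (\<forall>x\<in>J (head G e). \<forall>y\<in>J (head G e). dist (f e x) (f e y) = r * dist x y))) \<and>
     (\<forall>v\<in>verts G. \<forall>e\<in>out_arcs G v. \<forall>e'\<in>out_arcs G v. e \<noteq> e' \<longrightarrow>
        interior (f e ` J (head G e)) \<inter> interior (f e' ` J (head G e')) = {})"

definition invariant_family ::
    "('v, 'e) pre_digraph \<Rightarrow> ('v \<Rightarrow> 'a::euclidean_space set) \<Rightarrow> ('e \<Rightarrow> 'a \<Rightarrow> 'a) \<Rightarrow>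
     ('v \<Rightarrow> 'a set) \<Rightarrow> bool" where
  "invariant_family G J f K \<longleftrightarrow>
     (\<forall>v\<in>verts G. compact (K v) \<and> K v \<noteq> {} \<and> K v \<subseteq> J v \<and>
        K v = (\<Union>e\<in>out_arcs G v. f e ` K (head G e)))"

text \<open>\<open>K\<close> is \<^emph>\<open>the\<close> family of invariant sets of a graph-directed system.\<close>

definition invariant_sets_of ::
    "('v, 'e) pre_digraph \<Rightarrow> ('v \<Rightarrow> 'a::euclidean_space set) \<Rightarrow> ('e \<Rightarrow> 'a \<Rightarrow> 'a) \<Rightarrow>
     ('v \<Rightarrow> 'a set) \<Rightarrow> bool" where
  "invariant_sets_of G J f K \<longleftrightarrow>
     graph_directed_ifs G J f \<and> invariant_family G J f K \<and>
     (\<forall>K'. invariant_family G J f K' \<longrightarrow> (\<forall>v\<in>verts G. K' v = K v))"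

datatype colour = Omega | Gamma

definition labyrinth_digraph ::
    "triangle set \<Rightarrow> triangle set \<Rightarrow> triangle set \<Rightarrow> triangle set \<Rightarrow>
     (colour, colour \<times> triangle \<times> colour) pre_digraph" where
  "labyrinth_digraph W W' Y Y' =
    \<lparr>verts = {Omega, Gamma},
     arcs = {Omega} \<times> W \<times> {Omega} \<union> {Omega} \<times> W' \<times> {Gamma} \<union>
            {Gamma} \<times> Y \<times> {Gamma} \<union> {Gamma} \<times> Y' \<times> {Omega},
     tail = fst, head = snd \<circ> snd\<rparr>"

definition have_graph_directed_structure ::
    "triangle set \<Rightarrow> triangle set \<Rightarrow> triangle set \<Rightarrow> triangle set \<Rightarrow>
     point set \<Rightarrow> point set \<Rightarrow> bool" where
  "have_graph_directed_structure W W' Y Y' Lw Ly \<longleftrightarrow>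
     invariant_sets_of (labyrinth_digraph W W' Y Y') (\<lambda>_. region T1)
       (\<lambda>(_, D, _). tri_map D) (case_colour Lw Ly)"

section \<open>Fractal dimensions\<close>

text \<open>$|U|^s$ with the conventions $|\emptyset|^s = 0$ and $|U|^0 = 1$ for nonempty \<open>U\<close>
  (\<open>0 powr 0\<close> would be 0).\<close>

definition diam_pow :: "real \<Rightarrow> 'a::metric_space set \<Rightarrow> real" where
  "diam_pow s U = (if U = {} then 0 else if s = 0 then 1 else diameter U powr s)"

text \<open>Boundedness must be required separately, as \<open>diameter\<close> is unspecified on unbounded
  sets.\<close>

definition hausdorff_premeasure :: "real \<Rightarrow> real \<Rightarrow> 'a::metric_space set \<Rightarrow> ennreal" where
  "hausdorff_premeasure s \<delta> A =
     Inf {\<Sum>n. ennreal (diam_pow s (U n)) | U :: nat \<Rightarrow> 'a set.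
            A \<subseteq> (\<Union>n. U n) \<and> (\<forall>n. bounded (U n) \<and> diameter (U n) \<le> \<delta>)}"

definition hausdorff_measure :: "real \<Rightarrow> 'a::metric_space set \<Rightarrow> ennreal" where
  "hausdorff_measure s A = (SUP \<delta>\<in>{0<..}. hausdorff_premeasure s \<delta> A)"

definition hausdorff_dim :: "'a::metric_space set \<Rightarrow> ereal" where
  "hausdorff_dim A = Inf {ereal s | s. 0 \<le> s \<and> hausdorff_measure s A = 0}"

text \<open>The least number of sets of diameter at most \<open>\<delta>\<close> covering \<open>A\<close>, meaningful
  for totally bounded \<open>A\<close>.\<close>

definition covering_number :: "real \<Rightarrow> 'a::metric_space set \<Rightarrow> nat" where
  "covering_number \<delta> A =
     Inf {card C | C :: 'a set set.
            finite C \<and> A \<subseteq> \<Union>C \<and> (\<forall>U\<in>C. bounded U \<and> diameter U \<le> \<delta>)}"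

text \<open>The box-counting dimension exists (lower and upper one agree) and equals \<open>d\<close>.\<close>

definition has_box_dim :: "'a::metric_space set \<Rightarrow> real \<Rightarrow> bool" where
  "has_box_dim A d \<longleftrightarrow>
     ((\<lambda>\<delta>. ln (real (covering_number \<delta> A)) / - ln \<delta>) \<longlongrightarrow> d) (at_right 0)"

end

theory Submission
  imports Defs "HOL-Real_Asymp.Real_Asymp"
begin

text \<open>Weight the cells of level \<open>n\<close> by a positive eigenvector of the adjacency matrix of the
  graph, divided by \<open>lam ^ n\<close>: the weight of a cell is then the sum of the weights of its
  children. Comparing total weights bounds the number of cells of level \<open>n\<close> by a multiple of
  \<open>lam ^ n\<close>, which gives the upper bounds for both dimensions. For the lower bounds, a ball
  of radius about \<open>m ^ -n\<close> meets boundedly many cells of level \<open>n\<close>, because their centres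
  are distinct points of a lattice of mesh comparable to \<open>m ^ -n\<close>; hence it carries weight
  at most a constant times the \<open>s\<close>-th power of its radius, \<open>s = log lam / log m\<close>. By
  compactness only finite covers by balls matter, so finitely many levels suffice and no limit
  measure has to be constructed.\<close>

section \<open>Dimension estimates from two-sided covering bounds\<close>

text \<open>The eigenvalue equation for the weights (|W'|, lam - |W|) reduces to (lam - |W|) (lam -
  |Y|) = |W'| |Y'|, whose larger root is the stated lam. As W' and Y' are non-empty, lam exceeds |W|
  and |Y|, so the weights are positive; the exits property gives |W| >= 1, hence lam > 1 and s > 0.
  All maps have the same ratio 1/m, so a level number can stand for a scale. Two obstacles shape the
  proof. The map of a triangle is specified on \<open>region T1\<close> only, whereas the lower
  bound pulls arbitrary balls back along the maps; it is therefore replaced by its affine extension,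
  and the two are identified on subsets of \<open>region T1\<close>. Moreover, neighbouring cells
  share sides and vertices, so cells as closed sets are not disjoint; the markers are taken in the
  interior, where images along different arcs leaving a vertex are disjoint.\<close>

lemma hausdorff_dim_le:
  assumes "0 \<le> s" and null: "\<And>t. s < t \<Longrightarrow> hausdorff_measure t A = 0"
  shows "hausdorff_dim A \<le> ereal s"
proof (rule ereal_le_epsilon2)
  fix \<epsilon> :: real assume "0 < \<epsilon>"
  then have "ereal (s + \<epsilon>) \<in> {ereal t |t. 0 \<le> t \<and> hausdorff_measure t A = 0}"
    using assms by auto
  then show "hausdorff_dim A \<le> ereal s + ereal \<epsilon>"
    unfolding hausdorff_dim_def by (simp add: Inf_lower)
qed

lemma hausdorff_premeasure_le_finite_cover:
  fixes A :: "'a::metric_space set"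
  assumes "finite C"
    "A \<subseteq> \<Union>C"
    "\<And>U. U \<in> C \<Longrightarrow> bounded U \<and> diameter U \<le> d"
    "d \<le> \<delta>"
    "0 < d"
    "0 < t"
  shows "hausdorff_premeasure t \<delta> A \<le> ennreal (real (card C) * d powr t)"
proof -
  obtain f where f: "bij_betw f {0..<card C} C"
    using ex_bij_betw_nat_finite[OF \<open>finite C\<close>] by blast
  \<comment> \<open>Padding by the empty set is free, since \<open>diam_pow\<close> vanishes
    there.\<close>
  define U where "U n = (if n < card C then f n else {})" for n
  have U_in: "U n \<in> C" if "n < card C" for n
    using f that by (auto simp: U_def bij_betw_def)
  have "\<Union>C \<subseteq> (\<Union>n. U n)"
  proof
    fix x assume "x \<in> \<Union>C"
    then obtain V where V: "V \<in> C" "x \<in> V" by blast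
    then have "V \<in> f ` {0..<card C}" using f unfolding bij_betw_def by blast
    then obtain n where "n < card C" "f n = V" by auto
    then show "x \<in> (\<Union>n. U n)" using V(2) by (auto simp: U_def)
  qed
  with assms(2) have "A \<subseteq> (\<Union>n. U n)" by (rule order_trans)
  moreover have "bounded (U n) \<and> diameter (U n) \<le> \<delta>" for n
    using assms(3)[OF U_in[of n]] assms(4,5) by (cases "n < card C") (auto simp: U_def)
  ultimately have "hausdorff_premeasure t \<delta> A \<le> (\<Sum>n. ennreal (diam_pow t (U n)))"
    unfolding hausdorff_premeasure_def by (intro Inf_lower) blast
  also have "\<dots> = (\<Sum>n<card C. ennreal (diam_pow t (U n)))"
    by (rule suminf_finite) (auto simp: U_def diam_pow_def)
  also have "\<dots> \<le> (\<Sum>n<card C. ennreal (d powr t))"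
  proof (intro sum_mono ennreal_leI)
    fix n assume "n \<in> {..<card C}"
    then have "bounded (U n)" "diameter (U n) \<le> d" using assms(3) U_in by auto
    then show "diam_pow t (U n) \<le> d powr t"
      using \<open>0 < t\<close> by (auto simp: diam_pow_def intro!: powr_mono2 diameter_ge_0)
  qed
  also have "\<dots> = ennreal (real (card C) * d powr t)"
    by (simp add: ennreal_mult'' ennreal_of_nat_eq_real_of_nat)
  finally show ?thesis .
qed

lemma hausdorff_measure_eq_0:
  assumes "\<And>\<delta> \<epsilon>. 0 < \<delta> \<Longrightarrow> 0 < \<epsilon> \<Longrightarrow> hausdorff_premeasure t \<delta> A \<le> ennreal \<epsilon>"
  shows "hausdorff_measure t A = 0"
proof -
  have "hausdorff_premeasure t \<delta> A = 0" if "0 < \<delta>" for \<delta>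
    using ennreal_le_epsilon[of 0 "hausdorff_premeasure t \<delta> A"] assms[OF that]
    by (metis add_0 bot_ennreal le_zero_eq)
  then show ?thesis
    by (auto simp: hausdorff_measure_def intro!: antisym SUP_least)
qed

text \<open>Any set of diameter \<open>d\<close> is enlarged to an open ball whose \<open>s\<close>-th power exceeds
  \<open>d powr s\<close> by a summable amount; compactness then makes the cover finite.\<close>

lemma hausdorff_dim_ge:
  fixes A :: "'a::metric_space set"
  assumes "compact A" "0 < s" "0 < c"
    and balls: "\<And>I x \<rho>. finite I \<Longrightarrow> (\<And>i::nat. i \<in> I \<Longrightarrow> 0 < \<rho> i) \<Longrightarrow>
      A \<subseteq> (\<Union>i\<in>I. ball (x i) (\<rho> i)) \<Longrightarrow> c \<le> (\<Sum>i\<in>I. \<rho> i powr s)"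
  shows "ereal s \<le> hausdorff_dim A"
  unfolding hausdorff_dim_def
proof (rule Inf_greatest, clarify)
  fix t :: real assume "0 \<le> t" and null: "hausdorff_measure t A = 0"
  have "s \<le> t"
  proof (rule ccontr)
    assume "\<not> s \<le> t"
    have "hausdorff_premeasure t 1 A \<le> hausdorff_measure t A"
      unfolding hausdorff_measure_def by (rule SUP_upper) simp
    then have "hausdorff_premeasure t 1 A < ennreal (c / 2)"
      using null \<open>0 < c\<close> by simp
    then obtain U :: "nat \<Rightarrow> 'a set" where U: "A \<subseteq> (\<Union>n. U n)"
      "\<And>n. bounded (U n)" "\<And>n. diameter (U n) \<le> 1"
      and sum: "(\<Sum>n. ennreal (diam_pow t (U n))) < ennreal (c / 2)"
      unfolding hausdorff_premeasure_def Inf_less_iff by blast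
    have pos: "0 \<le> diam_pow t (U n)" for n by (simp add: diam_pow_def)
    \<comment> \<open>The added terms sum to c/2, which together with the strict bound c/2 on the
      cover stays below c. Being positive, they make each radius exceed the diameter, even a zero
      one.\<close>
    define \<rho> where "\<rho> n = (diameter (U n) powr s + c * (1/2)^n / 4) powr (1 / s)" for n
    have \<rho>_powr: "\<rho> n powr s = diameter (U n) powr s + c * (1/2)^n / 4" for n
      using \<open>0 < s\<close> \<open>0 < c\<close> by (simp add: \<rho>_def powr_powr add_nonneg_nonneg)
    have \<rho>_gt: "diameter (U n) < \<rho> n" for n
    proof -
      have "diameter (U n) = (diameter (U n) powr s) powr (1 / s)"
        using \<open>0 < s\<close> diameter_ge_0[OF U(2)] by (simp add: powr_powr)
      also have "\<dots> < \<rho> n"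
        unfolding \<rho>_def using \<open>0 < s\<close> \<open>0 < c\<close> by (intro powr_less_mono2) auto
      finally show ?thesis .
    qed
    have \<rho>_pos: "0 < \<rho> n" for n
      using \<rho>_gt[of n] diameter_ge_0[OF U(2)[of n]] by linarith
    define x where "x n = (SOME y. y \<in> U n)" for n
    have sub: "U n \<subseteq> ball (x n) (\<rho> n)" for n
    proof
      fix y assume y: "y \<in> U n"
      then have "x n \<in> U n" unfolding x_def by (rule someI)
      then show "y \<in> ball (x n) (\<rho> n)"
        using diameter_bounded_bound[OF U(2) _ y] \<rho>_gt[of n] by fastforce
    qed
    \<comment> \<open>Diameters are at most 1 and t < s, so the larger exponent gives the smaller
      power. For t = 0 and non-empty \<open>U n\<close> the right-hand side is 1.\<close>
    have le: "diameter (U n) powr s \<le> diam_pow t (U n)" for n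
    proof (cases "U n = {}")
      case False
      have "diameter (U n) powr s \<le> diameter (U n) powr t"
        using diameter_ge_0[OF U(2)[of n]] U(3)[of n] \<open>\<not> s \<le> t\<close>
        by (cases "diameter (U n) = 0") (auto intro: powr_mono')
      moreover have "diameter (U n) powr s \<le> 1"
        using diameter_ge_0[OF U(2)[of n]] U(3)[of n] \<open>0 < s\<close> by (simp add: powr_le1)
      ultimately show ?thesis using False by (simp add: diam_pow_def)
    qed (simp add: diam_pow_def)
    obtain I where I: "finite I" "A \<subseteq> (\<Union>i\<in>I. ball (x i) (\<rho> i))"
    proof (rule compactE_image[OF \<open>compact A\<close>, of UNIV "\<lambda>n. ball (x n) (\<rho> n)"])
      show "A \<subseteq> (\<Union>n. ball (x n) (\<rho> n))" using U(1) sub by blast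
    qed auto
    have "c \<le> (\<Sum>i\<in>I. \<rho> i powr s)" by (rule balls[OF I(1) \<rho>_pos I(2)])
    also have "\<dots> \<le> (\<Sum>i\<in>I. diam_pow t (U i)) + (\<Sum>i\<in>I. c * (1/2)^i / 4)"
      by (simp add: \<rho>_powr sum.distrib[symmetric] sum_mono le)
    also have "(\<Sum>i\<in>I. diam_pow t (U i)) < c / 2"
    proof -
      have "ennreal (\<Sum>i\<in>I. diam_pow t (U i)) = (\<Sum>i\<in>I. ennreal (diam_pow t (U i)))"
        using pos by (simp add: sum_ennreal)
      also have "\<dots> \<le> (\<Sum>n. ennreal (diam_pow t (U n)))"
        by (rule sum_le_suminf) (auto simp: I(1))
      also note sum
      finally show ?thesis using \<open>0 < c\<close> pos by (simp add: ennreal_less_iff sum_nonneg)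
    qed
    also have "(\<Sum>i\<in>I. c * (1/2)^i / 4) \<le> (\<Sum>i. c * (1/2)^i / 4)"
      using \<open>0 < c\<close> by (intro sum_le_suminf I(1)) (auto intro!: summable_divide summable_mult summable_geometric)
    also have "(\<Sum>i. c * (1/2)^i / 4) = c / 2"
    proof -
      have "(\<lambda>i. c / 4 * (1/2)^i) sums (c / 4 * (1 / (1 - 1/2)))"
        by (intro sums_mult geometric_sums) simp
      then show ?thesis by (simp add: sums_iff)
    qed
    finally show False by simp
  qed
  then show "ereal s \<le> ereal t" by simp
qed

section \<open>Covering numbers and the box-counting dimension\<close>

lemma covering_number_le:
  assumes "finite C"
    "A \<subseteq> \<Union>C"
    "\<And>U. U \<in> C \<Longrightarrow> bounded U \<and> diameter U \<le> \<delta>"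
  shows "covering_number \<delta> A \<le> card C"
  unfolding covering_number_def using assms by (intro cInf_lower) auto

text \<open>An infimum of natural numbers is a minimum once one finite cover is known to
  exist.\<close>

lemma covering_number_attained:
  fixes A :: "'a::metric_space set"
  assumes "finite C"
    "A \<subseteq> \<Union>C"
    "\<And>U. U \<in> C \<Longrightarrow> bounded U \<and> diameter U \<le> \<delta>"
  obtains C' where "finite C'"
    "A \<subseteq> \<Union>C'"
    "\<And>U. U \<in> C' \<Longrightarrow> bounded U \<and> diameter U \<le> \<delta>"
    "covering_number \<delta> A = card C'"
proof -
  have "covering_number \<delta> A \<in> {card C | C. finite C \<and> A \<subseteq> \<Union>C \<and>
      (\<forall>U\<in>C. bounded U \<and> diameter U \<le> \<delta>)}"
    unfolding covering_number_def using assms by (intro Inf_nat_def1) blast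
  then show ?thesis using that by blast
qed

text \<open>A constant factor changes the quotient only by ln a / - ln \<delta>, which vanishes in
  the limit.\<close>

lemma has_box_dimI:
  assumes "0 < a" "0 < b"
    and bounds: "\<And>\<delta>. 0 < \<delta> \<Longrightarrow> \<delta> < 1 \<Longrightarrow> a * \<delta> powr (-s) \<le> real (covering_number \<delta> A) \<and>
      real (covering_number \<delta> A) \<le> b * \<delta> powr (-s)"
  shows "has_box_dim A s"
  unfolding has_box_dim_def
proof (rule tendsto_sandwich)
  have lim: "((\<lambda>\<delta>. ln (k * \<delta> powr (-s)) / - ln \<delta>) \<longlongrightarrow> s) (at_right 0)" if "0 < k" for k :: real
    using that by real_asymp
  show "((\<lambda>\<delta>. ln (a * \<delta> powr (-s)) / - ln \<delta>) \<longlongrightarrow> s) (at_right 0)"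
    "((\<lambda>\<delta>. ln (b * \<delta> powr (-s)) / - ln \<delta>) \<longlongrightarrow> s) (at_right 0)"
    using lim assms by blast+
  have ev: "eventually (\<lambda>\<delta>. 0 < \<delta> \<and> \<delta> < (1::real)) (at_right 0)"
    by (auto simp: eventually_at_right_field intro!: exI[of _ 1])
  have pos: "0 < a * \<delta> powr (-s)" if "0 < \<delta>" for \<delta> using that assms(1) by simp
  show "eventually (\<lambda>\<delta>. ln (a * \<delta> powr (-s)) / - ln \<delta> \<le> ln (real (covering_number \<delta> A)) / - ln \<delta>)
      (at_right 0)"
    using ev
  proof eventually_elim
    case (elim \<delta>)
    then show ?case using bounds[of \<delta>] pos[of \<delta>]
      by (intro divide_right_mono) (auto intro!: ln_mono simp: less_imp_le)
  qed
  show "eventually (\<lambda>\<delta>. ln (real (covering_number \<delta> A)) / - ln \<delta> \<le> ln (b * \<delta> powr (-s)) / - ln \<delta>)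
      (at_right 0)"
    using ev
  proof eventually_elim
    case (elim \<delta>)
    then have "0 < real (covering_number \<delta> A)" using bounds[of \<delta>] pos[of \<delta>] by linarith
    then show ?case using bounds[of \<delta>] elim
      by (intro divide_right_mono) (auto intro!: ln_mono simp: less_imp_le)
  qed
qed

section \<open>Attractors of graph-directed systems of similarities\<close>

text \<open>Distances are scaled on the whole space, not merely on \<open>T\<close>: the maps are
  then injective everywhere, and arbitrary balls can be pulled back.\<close>

locale graph_similarities =
  fixes E :: "'v \<Rightarrow> 'e set" and target :: "'e \<Rightarrow> 'v"
    and F :: "'e \<Rightarrow> 'a::euclidean_space \<Rightarrow> 'a" and T :: "'a set" and r :: real
  assumes finite_E: "finite (E v)" and E_nonempty: "E v \<noteq> {}"
    and compact_T: "compact T" and T_nonempty: "T \<noteq> {}"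
    and F_T: "e \<in> E v \<Longrightarrow> F e ` T \<subseteq> T"
    and F_dist: "e \<in> E v \<Longrightarrow> dist (F e x) (F e y) = r * dist x y"
    and r_pos: "0 < r" and r_less_1: "r < 1"
begin

text \<open>The Hutchinson operator on families of sets indexed by the vertices.\<close>

definition step :: "('v \<Rightarrow> 'a set) \<Rightarrow> 'v \<Rightarrow> 'a set" where
  "step X v = (\<Union>e\<in>E v. F e ` X (target e))"

definition approx :: "nat \<Rightarrow> 'v \<Rightarrow> 'a set" where
  "approx n = (step ^^ n) (\<lambda>_. T)"

definition attractor :: "'v \<Rightarrow> 'a set" where
  "attractor v = (\<Inter>n. approx n v)"

lemma approx_0 [simp]: "approx 0 v = T"
  by (simp add: approx_def)

lemma approx_Suc: "approx (Suc n) v = (\<Union>e\<in>E v. F e ` approx n (target e))"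
  by (simp add: approx_def step_def)

lemma inj_F: "e \<in> E v \<Longrightarrow> inj (F e)"
  using F_dist r_pos by (metis (no_types, lifting) dist_eq_0_iff injI mult_eq_0_iff order_less_irrefl)

lemma continuous_on_F: "e \<in> E v \<Longrightarrow> continuous_on S (F e)"
  by (rule lipschitz_on_continuous_on[of r], rule lipschitz_onI) (auto simp: F_dist r_pos less_imp_le)

lemma approx_Suc_subset: "approx (Suc n) v \<subseteq> approx n v"
proof (induction n arbitrary: v)
  case 0 then show ?case using F_T by (auto simp: approx_Suc)
next
  case (Suc n)
  have "(\<Union>e\<in>E v. F e ` approx (Suc n) (target e)) \<subseteq> (\<Union>e\<in>E v. F e ` approx n (target e))"
    using Suc by blast
  then show ?case unfolding approx_Suc[symmetric] .
qed

lemma approx_antimono: "n \<le> k \<Longrightarrow> approx k v \<subseteq> approx n v"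
  using approx_Suc_subset by (rule lift_Suc_antimono_le)

lemma attractor_subset: "attractor v \<subseteq> T"
  unfolding attractor_def using approx_0 by blast

lemma compact_approx: "compact (approx n v)"
  by (induction n arbitrary: v)
    (auto simp: approx_Suc compact_T finite_E intro!: compact_UN compact_continuous_image continuous_on_F)

lemma approx_nonempty: "approx n v \<noteq> {}"
  by (induction n arbitrary: v) (auto simp: approx_Suc T_nonempty E_nonempty)

lemma compact_attractor: "compact (attractor v)"
  unfolding attractor_def by (intro compact_Inter) (auto intro: compact_approx)

lemma attractor_nonempty: "attractor v \<noteq> {}"
  unfolding attractor_def
  by (rule compact_nest) (auto simp: compact_approx approx_nonempty dest: approx_antimono)

text \<open>A point of the attractor lies, for every \<open>n\<close>, in the \<open>n\<close>-th approximation along some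
  arc; since there are finitely many arcs and the approximations decrease, one arc serves all
  \<open>n\<close>.\<close>

lemma attractor_unfold: "attractor v = (\<Union>e\<in>E v. F e ` attractor (target e))"
proof
  show "(\<Union>e\<in>E v. F e ` attractor (target e)) \<subseteq> attractor v"
  proof clarify
    fix e x assume e: "e \<in> E v" and x: "x \<in> attractor (target e)"
    have "F e x \<in> approx (Suc n) v" for n
      using e x by (auto simp: approx_Suc attractor_def)
    then show "F e x \<in> attractor v"
      using approx_Suc_subset unfolding attractor_def by blast
  qed
  show "attractor v \<subseteq> (\<Union>e\<in>E v. F e ` attractor (target e))"
  proof
    fix x assume "x \<in> attractor v"
    then have "\<forall>n. \<exists>e\<in>E v. x \<in> F e ` approx n (target e)"
      unfolding attractor_def using approx_Suc by blast
    then obtain e where e: "\<And>n. e n \<in> E v" "\<And>n. x \<in> F (e n) ` approx n (target (e n))"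
      by metis
    have "finite (range e)" using e(1) finite_E by (meson finite_subset image_subsetI)
    then obtain e0 where inf: "infinite (e -` {e0})"
      using inf_img_fin_dom[of e UNIV] by auto
    then have "e -` {e0} \<noteq> {}" by auto
    then obtain n0 where "e n0 = e0" by blast
    then have e0: "e0 \<in> E v" using e(1) by blast
    \<comment> \<open>Injectivity makes this single preimage serve all levels.\<close>
    obtain y where y: "x = F e0 y" using e(2)[of n0] \<open>e n0 = e0\<close> by blast
    have "y \<in> approx n (target e0)" for n
    proof -
      obtain k where k: "n \<le> k" "e k = e0" using inf
        by (auto simp: infinite_nat_iff_unbounded_le)
      then have "F e0 y \<in> F e0 ` approx k (target e0)" using e(2)[of k] y by simp
      then have "y \<in> approx k (target e0)" using inj_F[OF e0] by (simp add: inj_image_mem_iff)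
      then show ?thesis using approx_antimono[OF k(1)] by blast
    qed
    then show "x \<in> (\<Union>e\<in>E v. F e ` attractor (target e))"
      using y e0 unfolding attractor_def by blast
  qed
qed

text \<open>Iterating the fixed-point equation places \<open>K v\<close> inside every approximation.
  Conversely, each point of the n-th approximation is within \<open>r ^ n * diameter T\<close> of
  \<open>K v\<close>, so the attractor lies in the closure of \<open>K v\<close>, which is
  \<open>K v\<close> itself.\<close>

lemma attractor_unique:
  assumes K: "\<And>v. compact (K v)" "\<And>v. K v \<noteq> {}" "\<And>v. K v \<subseteq> T"
    and fixpoint: "\<And>v. K v = (\<Union>e\<in>E v. F e ` K (target e))"
  shows "K v = attractor v"
proof
  have "K v \<subseteq> approx n v" for n v
  proof (induction n arbitrary: v)
    case 0 then show ?case using K(3) by simp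
  next
    case (Suc n) then show ?case unfolding approx_Suc by (subst fixpoint) blast
  qed
  then show "K v \<subseteq> attractor v" unfolding attractor_def by blast
  have close: "\<exists>y\<in>K v. dist x y \<le> r ^ n * diameter T" if "x \<in> approx n v" for n v x
    using that
  proof (induction n arbitrary: v x)
    case 0
    obtain y where "y \<in> K v" using K(2) by blast
    then show ?case
      using 0 K(3) diameter_bounded_bound[OF compact_imp_bounded[OF compact_T]] by force
  next
    case (Suc n)
    then obtain e x' where e: "e \<in> E v" "x' \<in> approx n (target e)" "x = F e x'"
      by (auto simp: approx_Suc)
    then obtain y where y: "y \<in> K (target e)" "dist x' y \<le> r ^ n * diameter T"
      using Suc.IH by blast
    have "dist x (F e y) \<le> r ^ Suc n * diameter T"
      using F_dist[OF e(1)] e(3) y(2) r_pos by (simp add: mult.assoc)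
    then show ?case using fixpoint[of v] y(1) e(1) by blast
  qed
  show "attractor v \<subseteq> K v"
  proof
    fix x assume "x \<in> attractor v"
    have "\<exists>y\<in>K v. dist y x < \<epsilon>" if "0 < \<epsilon>" for \<epsilon>
    proof -
      have "(\<lambda>n. r ^ n * diameter T) \<longlonglongrightarrow> 0 * diameter T"
        using r_pos r_less_1 by (intro tendsto_intros LIMSEQ_realpow_zero) auto
      then have "eventually (\<lambda>n. r ^ n * diameter T < \<epsilon>) sequentially"
        using that by (intro order_tendstoD(2)) auto
      then obtain n where "r ^ n * diameter T < \<epsilon>"
        using eventually_happens' sequentially_bot by blast
      then show ?thesis using close[of x n v] \<open>x \<in> attractor v\<close>
        by (force simp: attractor_def dist_commute)
    qed
    then show "x \<in> K v"
      using compact_imp_closed[OF K(1)] closed_approachable by blast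
  qed
qed

end

section \<open>Dimension of the attractor\<close>

text \<open>The weights \<open>h\<close> form a positive eigenvector of the adjacency matrix. The finite sets
  \<open>L k\<close> contain a marker point for every cell of level \<open>k\<close>; disjointness and packing express
  the open set condition.\<close>

locale weighted_graph_similarities = graph_similarities E target F T r
  for E :: "'v \<Rightarrow> 'e set" and target :: "'e \<Rightarrow> 'v"
    and F :: "'e \<Rightarrow> 'a::euclidean_space \<Rightarrow> 'a" and T :: "'a set" and r :: real +
  fixes h :: "'v \<Rightarrow> real" and hmin hmax lam s :: real and L :: "nat \<Rightarrow> 'a set" and B :: nat
  assumes eigen: "(\<Sum>e\<in>E v. h (target e)) = lam * h v"
    and hmin_pos: "0 < hmin" and h_ge: "hmin \<le> h v" and h_le: "h v \<le> hmax"
    and s_pos: "0 < s" and lam_eq: "lam = (1 / r) powr s"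
    and finite_L: "finite (L k)" and L_0: "L 0 \<inter> T \<noteq> {}"
    and F_L: "e \<in> E v \<Longrightarrow> F e ` L k \<subseteq> L (Suc k)"
    and F_L_disjoint: "e \<in> E v \<Longrightarrow> e' \<in> E v \<Longrightarrow> e \<noteq> e' \<Longrightarrow> F e ` L k \<inter> F e' ` L k = {}"
    and packing: "card (L k \<inter> cball x ((1 + diameter T) * r ^ k)) \<le> B"
begin

lemma h_pos: "0 < h v"
  using hmin_pos h_ge by (meson less_le_trans)

lemma hmax_pos: "0 < hmax"
  using h_pos h_le by (meson less_le_trans)

lemma lam_pos: "0 < lam"
  using r_pos by (simp add: lam_eq)

lemma lam_power: "lam ^ k = (1 / r ^ k) powr s"
proof -
  have "lam ^ k = lam powr real k" by (simp add: powr_realpow lam_pos)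
  also have "\<dots> = ((1 / r) powr real k) powr s" by (simp add: lam_eq powr_powr mult.commute)
  also have "(1 / r) powr real k = 1 / r ^ k" using r_pos by (simp add: powr_realpow power_divide)
  finally show ?thesis .
qed

text \<open>Finds the level whose cells are comparable in size to \<rho>. The least n with r^n <
  \<rho> is positive because r^0 = 1 exceeds \<rho>.\<close>

lemma scale_exists:
  assumes "0 < \<rho>" "\<rho> < 1"
  obtains k where "\<rho> \<le> r ^ k" "r ^ Suc k < \<rho>"
proof -
  define n where "n = (LEAST n. r ^ n < \<rho>)"
  have "\<exists>n. r ^ n < \<rho>" using real_arch_pow_inv[OF assms(1) r_less_1] .
  then have n: "r ^ n < \<rho>" unfolding n_def by (rule LeastI_ex)
  then obtain k where k: "n = Suc k" using assms(2) by (cases n) auto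
  have "\<not> r ^ k < \<rho>" using not_less_Least[of k "\<lambda>n. r ^ n < \<rho>"] k unfolding n_def by simp
  then show ?thesis using n by (intro that[of k]) (auto simp: k)
qed

subsection \<open>Upper bounds\<close>

text \<open>Every covering set is counted with weight at least \<open>hmin\<close>. One refinement
  turns the bound into the sum of \<open>h (target e) * lam ^ n\<close> over the arcs, which the
  eigenvalue equation evaluates exactly, so no constant accumulates with n.\<close>

lemma approx_cover:
  "\<exists>C. finite C \<and> approx n v \<subseteq> \<Union>C \<and> (\<forall>U\<in>C. bounded U \<and> diameter U \<le> r ^ n * diameter T) \<and>
     real (card C) * hmin \<le> h v * lam ^ n"
proof (induction n arbitrary: v)
  case 0
  show ?case using compact_imp_bounded[OF compact_T] h_ge by (intro exI[of _ "{T}"]) auto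
next
  case (Suc n)
  then obtain C where C: "\<And>v. finite (C v)" "\<And>v. approx n v \<subseteq> \<Union>(C v)"
    "\<And>v U. U \<in> C v \<Longrightarrow> bounded U \<and> diameter U \<le> r ^ n * diameter T"
    "\<And>v. real (card (C v)) * hmin \<le> h v * lam ^ n" by metis
  define D where "D = (\<Union>e\<in>E v. (`) (F e) ` C (target e))"
  have "finite D" using C(1) finite_E by (auto simp: D_def)
  moreover have "approx (Suc n) v \<subseteq> \<Union>D"
  proof
    fix x assume "x \<in> approx (Suc n) v"
    then obtain e y where e: "e \<in> E v" "y \<in> approx n (target e)" "x = F e y"
      by (auto simp: approx_Suc)
    then obtain U where "U \<in> C (target e)" "y \<in> U" using C(2) by blast
    then show "x \<in> \<Union>D" using e unfolding D_def by blast
  qed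
  moreover have "bounded V \<and> diameter V \<le> r ^ Suc n * diameter T" if V: "V \<in> D" for V
  proof -
    obtain e U where e: "e \<in> E v" and U: "U \<in> C (target e)" "V = F e ` U"
      using V by (auto simp: D_def)
    have bd: "bounded U" "diameter U \<le> r ^ n * diameter T" using C(3) U(1) by auto
    have d: "dist x y \<le> r ^ Suc n * diameter T" if "x \<in> V" "y \<in> V" for x y
    proof -
      have "x \<in> F e ` U" "y \<in> F e ` U" using that U(2) by auto
      then obtain x' y' where xy: "x = F e x'" "y = F e y'" "x' \<in> U" "y' \<in> U"
        by blast
      then have "dist x' y' \<le> r ^ n * diameter T"
        using diameter_bounded_bound[OF bd(1)] bd(2) by force
      then show ?thesis using r_pos by (simp add: xy F_dist[OF e] mult.assoc)
    qed
    have "bounded V"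
    proof (cases "V = {}")
      case False
      then obtain x where "x \<in> V" by blast
      then show ?thesis using d unfolding bounded_def by blast
    qed simp
    moreover have "diameter V \<le> r ^ Suc n * diameter T"
      using d diameter_ge_0[OF compact_imp_bounded[OF compact_T]] r_pos
      by (intro diameter_le) (auto simp: dist_norm)
    ultimately show ?thesis by blast
  qed
  moreover have "real (card D) * hmin \<le> h v * lam ^ Suc n"
  proof -
    have "card D \<le> (\<Sum>e\<in>E v. card ((`) (F e) ` C (target e)))"
      unfolding D_def by (rule card_UN_le[OF finite_E])
    also have "\<dots> \<le> (\<Sum>e\<in>E v. card (C (target e)))"
      by (intro sum_mono card_image_le C(1))
    finally have "real (card D) * hmin \<le> (\<Sum>e\<in>E v. real (card (C (target e))) * hmin)"
      using hmin_pos by (simp flip: sum_distrib_right of_nat_sum)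
    also have "\<dots> \<le> (\<Sum>e\<in>E v. h (target e) * lam ^ n)" by (intro sum_mono C(4))
    also have "\<dots> = h v * lam ^ Suc n" by (simp add: eigen flip: sum_distrib_right)
    finally show ?thesis .
  qed
  ultimately show ?case by blast
qed

text \<open>The 1 added to the diameter keeps the size bound positive even if
  \<open>diameter T\<close> is 0.\<close>

lemma attractor_cover:
  obtains C where "finite C" "attractor v \<subseteq> \<Union>C"
    "\<And>U. U \<in> C \<Longrightarrow> bounded U \<and> diameter U \<le> r ^ n * (1 + diameter T)"
    "real (card C) \<le> hmax / hmin * lam ^ n"
proof -
  obtain C where C: "finite C" "approx n v \<subseteq> \<Union>C"
    "\<And>U. U \<in> C \<Longrightarrow> bounded U \<and> diameter U \<le> r ^ n * diameter T"
    "real (card C) * hmin \<le> h v * lam ^ n" using approx_cover by metis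
  have "attractor v \<subseteq> approx n v" by (auto simp: attractor_def)
  moreover have "r ^ n * diameter T \<le> r ^ n * (1 + diameter T)" using r_pos by simp
  moreover have "real (card C) * hmin \<le> hmax * lam ^ n"
    using C(4) h_le lam_pos by (smt (verit) mult_right_mono zero_le_power)
  ultimately show ?thesis
    using that[of C] C hmin_pos by (force simp: field_simps)
qed

lemma hausdorff_dim_attractor_le: "hausdorff_dim (attractor v) \<le> ereal s"
proof (rule hausdorff_dim_le)
  show "0 \<le> s" using s_pos by simp
  fix t assume "s < t"
  define q where "q = 1 + diameter T"
  have q: "0 < q" using diameter_ge_0[OF compact_imp_bounded[OF compact_T]] by (simp add: q_def)
  show "hausdorff_measure t (attractor v) = 0"
  proof (rule hausdorff_measure_eq_0)
    fix \<delta> \<epsilon> :: real assume "0 < \<delta>" "0 < \<epsilon>"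
    \<comment> \<open>The level-n cover costs a constant times the n-th power of
      \<open>r powr (t - s)\<close>, a number below 1 because t > s.\<close>
    have eq: "lam ^ n * (r ^ n * q) powr t = q powr t * (r powr (t - s)) ^ n" for n
    proof -
      have "lam ^ n = (r powr (-s)) ^ n" using r_pos by (simp add: lam_eq powr_divide powr_minus field_simps)
      moreover have "(r ^ n * q) powr t = q powr t * (r powr t) ^ n"
        using q r_pos by (simp add: powr_mult powr_realpow[symmetric] powr_powr mult.commute)
      moreover have "r powr (-s) * r powr t = r powr (t - s)" by (simp flip: powr_add)
      ultimately show ?thesis by (metis mult.left_commute power_mult_distrib)
    qed
    have lt1: "r powr (t - s) < 1" using r_pos r_less_1 \<open>s < t\<close> powr_less_mono2[of "t - s" r 1] by simp
    have "(\<lambda>n. hmax / hmin * (q powr t * (r powr (t - s)) ^ n)) \<longlonglongrightarrow> hmax / hmin * (q powr t * 0)"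
      using lt1 by (intro tendsto_intros LIMSEQ_realpow_zero) auto
    then have "eventually (\<lambda>n. hmax / hmin * (q powr t * (r powr (t - s)) ^ n) < \<epsilon>) sequentially"
      using \<open>0 < \<epsilon>\<close> by (simp add: order_tendstoD(2))
    moreover have "(\<lambda>n. r ^ n * q) \<longlonglongrightarrow> 0 * q"
      using r_pos r_less_1 by (intro tendsto_intros LIMSEQ_realpow_zero) auto
    then have "eventually (\<lambda>n. r ^ n * q < \<delta>) sequentially"
      using \<open>0 < \<delta>\<close> by (simp add: order_tendstoD(2))
    ultimately have "\<exists>n. hmax / hmin * (q powr t * (r powr (t - s)) ^ n) < \<epsilon> \<and> r ^ n * q < \<delta>"
      by (rule eventually_happens'[OF sequentially_bot eventually_conj])
    then obtain n where n: "hmax / hmin * (q powr t * (r powr (t - s)) ^ n) < \<epsilon>" "r ^ n * q < \<delta>"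
      by blast
    obtain C where C: "finite C" "attractor v \<subseteq> \<Union>C"
      "\<And>U. U \<in> C \<Longrightarrow> bounded U \<and> diameter U \<le> r ^ n * q"
      "real (card C) \<le> hmax / hmin * lam ^ n"
      using attractor_cover[of v n] unfolding q_def by metis
    have "hausdorff_premeasure t \<delta> (attractor v) \<le> ennreal (real (card C) * (r ^ n * q) powr t)"
      using C n(2) q r_pos s_pos \<open>s < t\<close> by (intro hausdorff_premeasure_le_finite_cover) auto
    also have "\<dots> \<le> ennreal \<epsilon>"
    proof (rule ennreal_leI)
      have "real (card C) * (r ^ n * q) powr t \<le> hmax / hmin * lam ^ n * (r ^ n * q) powr t"
        using C(4) by (intro mult_right_mono) auto
      also have "\<dots> \<le> \<epsilon>" using n(1) eq by (simp add: mult.assoc)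
      finally show "real (card C) * (r ^ n * q) powr t \<le> \<epsilon>" .
    qed
    finally show "hausdorff_premeasure t \<delta> (attractor v) \<le> ennreal \<epsilon>" .
  qed
qed

subsection \<open>Lower bounds by mass distribution\<close>

text \<open>\<open>mass n v\<close> is the total weight of the level-\<open>n\<close> cells whose part of the attractor
  meets a given set: an upper approximation, decreasing in \<open>n\<close>, of the natural measure.\<close>

primrec mass :: "nat \<Rightarrow> 'v \<Rightarrow> 'a set \<Rightarrow> real" where
  "mass 0 v S = (if S \<inter> attractor v = {} then 0 else h v)"
| "mass (Suc n) v S = (\<Sum>e\<in>E v. mass n (target e) (F e -` S)) / lam"

lemma mass_nonneg: "0 \<le> mass n v S"
  by (induction n arbitrary: v S) (auto simp: less_imp_le[OF h_pos] lam_pos less_imp_le sum_nonneg)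

text \<open>By the eigenvalue equation the children of a cell carry exactly its weight, so the total
  survives refinement.\<close>

lemma mass_full: "attractor v \<subseteq> S \<Longrightarrow> mass n v S = h v"
proof (induction n arbitrary: v S)
  case 0 then show ?case using attractor_nonempty[of v] by (auto simp: Int_absorb1)
next
  case (Suc n)
  have "mass n (target e) (F e -` S) = h (target e)" if "e \<in> E v" for e
    using Suc.prems attractor_unfold[of v] that by (intro Suc.IH) blast
  then show ?case using lam_pos by (simp add: eigen)
qed

lemma mass_UN_le: "finite I \<Longrightarrow> mass n v (\<Union>i\<in>I. S i) \<le> (\<Sum>i\<in>I. mass n v (S i))"
proof (induction n arbitrary: v S)
  case 0
  show ?case
  proof (cases "(\<Union>i\<in>I. S i) \<inter> attractor v = {}")
    case True
    then show ?thesis by (simp add: sum_nonneg less_imp_le[OF h_pos])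
  next
    case False
    then obtain i where i: "i \<in> I" "S i \<inter> attractor v \<noteq> {}" by blast
    have "mass 0 v (S i) \<le> (\<Sum>i\<in>I. mass 0 v (S i))"
      by (rule member_le_sum[OF i(1) mass_nonneg 0])
    then show ?thesis using i False by simp
  qed
next
  case (Suc n)
  have "mass (Suc n) v (\<Union>i\<in>I. S i) = (\<Sum>e\<in>E v. mass n (target e) (\<Union>i\<in>I. F e -` S i)) / lam"
    by (simp add: vimage_UN)
  also have "\<dots> \<le> (\<Sum>e\<in>E v. \<Sum>i\<in>I. mass n (target e) (F e -` S i)) / lam"
    using Suc lam_pos by (intro divide_right_mono sum_mono) auto
  also have "\<dots> = (\<Sum>i\<in>I. mass (Suc n) v (S i))"
    by (subst sum.swap) (simp add: sum_divide_distrib)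
  finally show ?case .
qed

text \<open>A cell missing \<open>S\<close> has no child meeting \<open>S\<close>, and otherwise its
  children weigh no more than the cell itself. The recursion passes this from level 0 to all
  levels.\<close>

lemma mass_Suc_le: "mass (Suc n) v S \<le> mass n v S"
proof (induction n arbitrary: v S)
  case 0
  show ?case
  proof (cases "S \<inter> attractor v = {}")
    case True
    then have "F e -` S \<inter> attractor (target e) = {}" if "e \<in> E v" for e
      using attractor_unfold[of v] that by blast
    then show ?thesis using True by simp
  next
    case False
    have "(\<Sum>e\<in>E v. mass 0 (target e) (F e -` S)) \<le> (\<Sum>e\<in>E v. h (target e))"
      by (intro sum_mono) (simp add: less_imp_le[OF h_pos])
    then show ?thesis using False lam_pos by (simp add: eigen field_simps)
  qed
next
  case (Suc n)
  have "(\<Sum>e\<in>E v. mass (Suc n) (target e) (F e -` S)) \<le> (\<Sum>e\<in>E v. mass n (target e) (F e -` S))"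
    by (intro sum_mono Suc)
  then have "(\<Sum>e\<in>E v. mass (Suc n) (target e) (F e -` S)) / lam \<le>
      (\<Sum>e\<in>E v. mass n (target e) (F e -` S)) / lam"
    by (rule divide_right_mono) (simp add: lam_pos less_imp_le)
  then show ?case unfolding mass.simps(2)[symmetric] .
qed

lemma mass_antimono: "n \<le> k \<Longrightarrow> mass k v S \<le> mass n v S"
  using mass_Suc_le by (rule lift_Suc_antimono_le)

text \<open>Each counted cell weighs at most \<open>hmax / lam ^ k\<close> and has a marker within
  its diameter of \<open>S\<close>. Counting markers counts cells, because images of markers along
  different arcs are disjoint.\<close>

lemma mass_le_card:
  "mass k v S \<le> hmax / lam ^ k * real (card (L k \<inter> {x. \<exists>y\<in>S. dist x y \<le> diameter T * r ^ k}))"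
proof (induction k arbitrary: v S)
  case 0
  show ?case
  proof (cases "S \<inter> attractor v = {}")
    case True then show ?thesis using hmax_pos by simp
  next
    case False
    then obtain y where y: "y \<in> S" "y \<in> T" using attractor_subset by blast
    obtain c where c: "c \<in> L 0" "c \<in> T" using L_0 by blast
    have "dist c y \<le> diameter T"
      by (rule diameter_bounded_bound[OF compact_imp_bounded[OF compact_T] c(2) y(2)])
    then have "c \<in> L 0 \<inter> {x. \<exists>y\<in>S. dist x y \<le> diameter T * r ^ 0}" using y c by auto
    then have "0 < card (L 0 \<inter> {x. \<exists>y\<in>S. dist x y \<le> diameter T * r ^ 0})"
      using finite_L unfolding card_gt_0_iff by blast
    then have "1 \<le> card (L 0 \<inter> {x. \<exists>y\<in>S. dist x y \<le> diameter T * r ^ 0})"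
      by linarith
    then have "hmax * 1 \<le> hmax * real (card (L 0 \<inter> {x. \<exists>y\<in>S. dist x y \<le> diameter T * r ^ 0}))"
      using hmax_pos by (intro mult_left_mono) auto
    then show ?thesis using False h_le[of v] by simp
  qed
next
  case (Suc k)
  define N where "N k S = L k \<inter> {x. \<exists>y\<in>S. dist x y \<le> diameter T * r ^ k}" for k S
  have fin: "finite (N k S)" for k S using finite_L by (simp add: N_def)
  have sub: "F e ` N k (F e -` S) \<subseteq> N (Suc k) S" if e: "e \<in> E v" for e
  proof clarify
    fix x assume "x \<in> N k (F e -` S)"
    then obtain y where "x \<in> L k" "F e y \<in> S" "dist x y \<le> diameter T * r ^ k"
      by (auto simp: N_def)
    moreover from this have "dist (F e x) (F e y) \<le> diameter T * r ^ Suc k"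
      using F_dist[OF e] r_pos by (simp add: mult.left_commute)
    ultimately show "F e x \<in> N (Suc k) S" using F_L[OF e] unfolding N_def by blast
  qed
  have "mass (Suc k) v S \<le> (\<Sum>e\<in>E v. hmax / lam ^ k * real (card (N k (F e -` S)))) / lam"
    unfolding mass.simps N_def using lam_pos by (intro divide_right_mono sum_mono Suc) auto
  also have "\<dots> = hmax / lam ^ Suc k * real (\<Sum>e\<in>E v. card (N k (F e -` S)))"
    by (simp add: sum_distrib_left sum_divide_distrib mult.commute[of lam])
  also have "(\<Sum>e\<in>E v. card (N k (F e -` S))) = (\<Sum>e\<in>E v. card (F e ` N k (F e -` S)))"
    by (intro sum.cong refl card_image[symmetric]) (meson inj_F inj_on_subset subset_UNIV)
  also have "\<dots> = card (\<Union>e\<in>E v. F e ` N k (F e -` S))"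
  proof (rule card_UN_disjoint[symmetric])
    show "\<forall>e\<in>E v. \<forall>e'\<in>E v. e \<noteq> e' \<longrightarrow> F e ` N k (F e -` S) \<inter> F e' ` N k (F e' -` S) = {}"
    proof (intro ballI impI)
      fix e e' assume "e \<in> E v" "e' \<in> E v" "e \<noteq> e'"
      then have "F e ` L k \<inter> F e' ` L k = {}" by (rule F_L_disjoint)
      then show "F e ` N k (F e -` S) \<inter> F e' ` N k (F e' -` S) = {}" unfolding N_def by blast
    qed
  qed (auto simp: finite_E fin)
  also have "hmax / lam ^ Suc k * real (card (\<Union>e\<in>E v. F e ` N k (F e -` S))) \<le>
      hmax / lam ^ Suc k * real (card (N (Suc k) S))"
    using hmax_pos lam_pos sub
    by (intro mult_left_mono of_nat_mono card_mono fin) (auto simp: less_imp_le)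
  finally show ?case unfolding N_def .
qed

text \<open>For \<rho> < 1 take the level with r^(k+1) < \<rho> \<le> r^k. The relevant markers lie
  within r^k plus \<open>diameter T * r ^ k\<close> of the centre, which is the radius in
  \<open>packing\<close>; passing from r^k to \<rho> costs one factor \<open>lam\<close>. Larger
  balls use level 0, where the mass is at most \<open>hmax\<close>: this is the 1 in the
  constant.\<close>

lemma mass_ball:
  assumes "0 < \<rho>"
  shows "\<exists>k. mass k v (ball x \<rho>) \<le> hmax * (1 + real B * lam) * \<rho> powr s"
proof (cases "\<rho> < 1")
  case False
  then have "1 \<le> \<rho> powr s" using s_pos by (simp add: ge_one_powr_ge_zero)
  have "mass 0 v (ball x \<rho>) \<le> hmax * 1 * 1" using h_le hmax_pos by (simp add: less_imp_le)
  also have "\<dots> \<le> hmax * (1 + real B * lam) * \<rho> powr s"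
    using \<open>1 \<le> \<rho> powr s\<close> hmax_pos lam_pos by (intro mult_mono) auto
  finally show ?thesis by blast
next
  case True
  then obtain k where k: "\<rho> \<le> r ^ k" "r ^ Suc k < \<rho>" using scale_exists[OF assms] by blast
  have "{z. \<exists>y\<in>ball x \<rho>. dist z y \<le> diameter T * r ^ k} \<subseteq> cball x ((1 + diameter T) * r ^ k)"
  proof clarify
    fix z y assume "y \<in> ball x \<rho>" "dist z y \<le> diameter T * r ^ k"
    then have "dist x z \<le> r ^ k + diameter T * r ^ k"
      using k(1) dist_triangle[of x z y] by (simp add: dist_commute)
    then show "z \<in> cball x ((1 + diameter T) * r ^ k)" by (simp add: algebra_simps)
  qed
  then have "card (L k \<inter> {z. \<exists>y\<in>ball x \<rho>. dist z y \<le> diameter T * r ^ k}) \<le>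
      card (L k \<inter> cball x ((1 + diameter T) * r ^ k))"
    using finite_L by (intro card_mono) auto
  also have "\<dots> \<le> B" by (rule packing)
  finally have card: "card (L k \<inter> {z. \<exists>y\<in>ball x \<rho>. dist z y \<le> diameter T * r ^ k}) \<le> B" .
  have "1 / lam ^ k = (r ^ k) powr s"
    unfolding lam_power using r_pos by (simp add: powr_divide)
  also have "\<dots> \<le> (\<rho> * (1 / r)) powr s"
    using k(2) r_pos s_pos by (intro powr_mono2) (auto simp: field_simps)
  also have "\<dots> = lam * \<rho> powr s"
    using assms r_pos by (subst powr_mult) (auto simp: lam_eq)
  finally have scale: "1 / lam ^ k \<le> lam * \<rho> powr s" .
  have "mass k v (ball x \<rho>) \<le>
      hmax / lam ^ k * real (card (L k \<inter> {z. \<exists>y\<in>ball x \<rho>. dist z y \<le> diameter T * r ^ k}))"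
    by (rule mass_le_card)
  also have "\<dots> \<le> hmax / lam ^ k * real B"
    using card hmax_pos lam_pos by (intro mult_left_mono) auto
  also have "\<dots> = hmax * real B * (1 / lam ^ k)" by simp
  also have "\<dots> \<le> hmax * real B * (lam * \<rho> powr s)"
    using hmax_pos by (intro mult_left_mono scale) auto
  also have "\<dots> \<le> hmax * (1 + real B * lam) * \<rho> powr s"
    using hmax_pos by (simp add: algebra_simps)
  finally show ?thesis by blast
qed

text \<open>A lower bound for the total mass, divided by the constant of
  \<open>mass_ball\<close>.\<close>

definition lower_const :: real where
  "lower_const = hmin / (hmax * (1 + real B * lam))"

lemma lower_const_pos: "0 < lower_const"
  using hmin_pos hmax_pos lam_pos by (auto simp: lower_const_def intro!: divide_pos_pos mult_pos_pos add_pos_nonneg)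

text \<open>Each ball has its own good level. Since the mass decreases with the level, all estimates
  hold at the maximal one, where subadditivity compares them with the total mass.\<close>

lemma lower_const_le_sum_balls:
  assumes "finite I"
    "\<And>i. i \<in> I \<Longrightarrow> 0 < \<rho> i"
    "attractor v \<subseteq> (\<Union>i\<in>I. ball (x i) (\<rho> i))"
  shows "lower_const \<le> (\<Sum>i\<in>I. \<rho> i powr s)"
proof -
  define c where "c = hmax * (1 + real B * lam)"
  have "0 < c" using hmax_pos lam_pos by (auto simp: c_def intro!: mult_pos_pos add_pos_nonneg)
  have "\<forall>i\<in>I. \<exists>k. mass k v (ball (x i) (\<rho> i)) \<le> c * \<rho> i powr s"
    unfolding c_def using mass_ball assms(2) by blast
  then obtain k where k: "\<And>i. i \<in> I \<Longrightarrow> mass (k i) v (ball (x i) (\<rho> i)) \<le> c * \<rho> i powr s"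
    by metis
  define N where "N = Max (k ` I)"
  have "hmin \<le> mass N v (\<Union>i\<in>I. ball (x i) (\<rho> i))"
    using mass_full[OF assms(3)] h_ge by simp
  also have "\<dots> \<le> (\<Sum>i\<in>I. mass N v (ball (x i) (\<rho> i)))" by (rule mass_UN_le[OF assms(1)])
  also have "\<dots> \<le> (\<Sum>i\<in>I. c * \<rho> i powr s)"
  proof (rule sum_mono)
    fix i assume i: "i \<in> I"
    then have "k i \<le> N" using assms(1) by (simp add: N_def)
    then show "mass N v (ball (x i) (\<rho> i)) \<le> c * \<rho> i powr s"
      using mass_antimono k[OF i] order_trans by blast
  qed
  finally have "hmin / c \<le> (\<Sum>i\<in>I. \<rho> i powr s)" using \<open>0 < c\<close>
    by (simp add: pos_divide_le_eq mult.commute flip: sum_distrib_left)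
  then show ?thesis unfolding lower_const_def c_def .
qed

theorem hausdorff_dim_attractor: "hausdorff_dim (attractor v) = ereal s"
proof (rule antisym[OF hausdorff_dim_attractor_le])
  show "ereal s \<le> hausdorff_dim (attractor v)"
    by (rule hausdorff_dim_ge[OF compact_attractor s_pos lower_const_pos])
      (rule lower_const_le_sum_balls)
qed

theorem has_box_dim_attractor: "has_box_dim (attractor v) s"
proof -
  define q where "q = 1 + diameter T"
  have q: "1 \<le> q" using diameter_ge_0[OF compact_imp_bounded[OF compact_T]] by (simp add: q_def)
  define b where "b = hmax / hmin * lam * q powr s"
  have "0 < b" using hmax_pos hmin_pos lam_pos q by (simp add: b_def)
  show ?thesis
  proof (rule has_box_dimI[OF _ \<open>0 < b\<close>])
    show "0 < lower_const * 2 powr (-s)" using lower_const_pos by simp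
    fix \<delta> :: real assume \<delta>: "0 < \<delta>" "\<delta> < 1"
    \<comment> \<open>Dividing by q makes the covering sets of level k + 1 have diameter at most
      \<delta>.\<close>
    have "0 < \<delta> / q" "\<delta> / q < 1" using \<delta> q by (auto simp: field_simps)
    then obtain k where k: "\<delta> / q \<le> r ^ k" "r ^ Suc k < \<delta> / q" by (rule scale_exists)
    obtain C where C: "finite C" "attractor v \<subseteq> \<Union>C"
      "\<And>U. U \<in> C \<Longrightarrow> bounded U \<and> diameter U \<le> r ^ Suc k * q"
      "real (card C) \<le> hmax / hmin * lam ^ Suc k"
      using attractor_cover[of v "Suc k"] unfolding q_def by metis
    have "r ^ Suc k * q \<le> \<delta>" using k(2) q by (simp add: field_simps)
    then have C': "\<And>U. U \<in> C \<Longrightarrow> bounded U \<and> diameter U \<le> \<delta>" using C(3) by fastforce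
    have "real (covering_number \<delta> (attractor v)) \<le> real (card C)"
      using covering_number_le[OF C(1,2) C'] by simp
    also have "\<dots> \<le> hmax / hmin * lam * lam ^ k" using C(4) by simp
    also have "\<dots> \<le> hmax / hmin * lam * (q powr s * \<delta> powr (-s))"
    proof -
      have "lam ^ k = (1 / r ^ k) powr s" by (rule lam_power)
      also have "\<dots> \<le> (q / \<delta>) powr s"
        using k(1) \<delta> q r_pos s_pos by (intro powr_mono2) (auto simp: field_simps)
      also have "\<dots> = q powr s * \<delta> powr (-s)"
        using q \<delta> by (simp add: powr_divide powr_minus_divide)
      finally show ?thesis using hmax_pos hmin_pos lam_pos by (intro mult_left_mono) auto
    qed
    finally have upper: "real (covering_number \<delta> (attractor v)) \<le> b * \<delta> powr (-s)"
      by (simp add: b_def mult.assoc)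
    obtain D where D: "finite D" "attractor v \<subseteq> \<Union>D"
      "\<And>U. U \<in> D \<Longrightarrow> bounded U \<and> diameter U \<le> \<delta>"
        "covering_number \<delta> (attractor v) = card D"
      using covering_number_attained[OF C(1,2) C'] by metis
    \<comment> \<open>The factor 2 leaves room for an open ball about a point of \<open>U\<close> to
      contain \<open>U\<close>, whose diameter may equal \<delta>; it reappears as
      \<open>2 powr (-s)\<close>.\<close>
    have "attractor v \<subseteq> (\<Union>U\<in>D. ball (SOME x. x \<in> U) (2 * \<delta>))"
    proof
      fix y assume "y \<in> attractor v"
      then obtain U where U: "U \<in> D" "y \<in> U" using D(2) by blast
      then have "(SOME x. x \<in> U) \<in> U" by (metis someI)
      then have "dist (SOME x. x \<in> U) y \<le> \<delta>"
        using D(3)[OF U(1)] diameter_bounded_bound[of U _ y] U(2) by force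
      then show "y \<in> (\<Union>U\<in>D. ball (SOME x. x \<in> U) (2 * \<delta>))" using U \<delta>(1) by force
    qed
    then have "lower_const \<le> (\<Sum>U\<in>D. (2 * \<delta>) powr s)"
      using D(1) \<delta>(1) by (intro lower_const_le_sum_balls) auto
    then have "lower_const * (2 * \<delta>) powr (-s) \<le> real (card D)"
      using \<delta>(1) by (simp add: powr_minus field_simps)
    then have "lower_const * 2 powr (-s) * \<delta> powr (-s) \<le> real (covering_number \<delta> (attractor v))"
      using \<delta>(1) D(4) by (simp add: powr_mult mult.assoc)
    with upper show "lower_const * 2 powr (-s) * \<delta> powr (-s) \<le> real (covering_number \<delta> (attractor v)) \<and>
        real (covering_number \<delta> (attractor v)) \<le> b * \<delta> powr (-s)" by blast
  qed
qed

end

section \<open>Barycentric coordinates\<close>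

text \<open>Affine functions on the whole plane inverting \<open>bary T1\<close>; a coordinate is
  negative beyond its edge.\<close>

definition bary2 :: "point \<Rightarrow> real" where "bary2 x = x $ 1 - x $ 2 / sqrt 3"
definition bary3 :: "point \<Rightarrow> real" where "bary3 x = 2 * x $ 2 / sqrt 3"
definition bary1 :: "point \<Rightarrow> real" where "bary1 x = 1 - bary2 x - bary3 x"

text \<open>The affine extension of \<open>tri_map D\<close> to the whole plane.\<close>

definition tri_affine :: "triangle \<Rightarrow> point \<Rightarrow> point" where
  "tri_affine D x = bary D (bary1 x, bary2 x, bary3 x)"

lemma tri_affine_Tri: "tri_affine (Tri A1 A2 A3) x = bary1 x *\<^sub>R A1 + bary2 x *\<^sub>R A2 + bary3 x *\<^sub>R A3"
  by (simp add: tri_affine_def)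

lemma bary_sum: "bary1 x + bary2 x + bary3 x = 1"
  by (simp add: bary1_def)

lemma P1_eq_0: "P1 = 0"
  by (simp add: P1_def vec_eq_iff forall_2)

lemma bary_P [simp]: "bary1 P1 = 1" "bary2 P1 = 0" "bary3 P1 = 0" "bary1 P2 = 0" "bary2 P2 = 1" "bary3 P2 = 0"
  "bary1 P3 = 0" "bary2 P3 = 0" "bary3 P3 = 1"
  by (auto simp: bary1_def bary2_def bary3_def P1_eq_0 P2_def P3_def)

lemma bary_affine:
  assumes "u + v + w = 1"
  shows "bary1 (u *\<^sub>R A + v *\<^sub>R B + w *\<^sub>R C) = u * bary1 A + v * bary1 B + w * bary1 C"
    and "bary2 (u *\<^sub>R A + v *\<^sub>R B + w *\<^sub>R C) = u * bary2 A + v * bary2 B + w * bary2 C"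
    and "bary3 (u *\<^sub>R A + v *\<^sub>R B + w *\<^sub>R C) = u * bary3 A + v * bary3 B + w * bary3 C"
proof -
  have u: "u = 1 - v - w" using assms by simp
  show "bary2 (u *\<^sub>R A + v *\<^sub>R B + w *\<^sub>R C) = u * bary2 A + v * bary2 B + w * bary2 C"
    "bary3 (u *\<^sub>R A + v *\<^sub>R B + w *\<^sub>R C) = u * bary3 A + v * bary3 B + w * bary3 C"
    "bary1 (u *\<^sub>R A + v *\<^sub>R B + w *\<^sub>R C) = u * bary1 A + v * bary1 B + w * bary1 C"
    unfolding u by (simp_all add: bary1_def bary2_def bary3_def algebra_simps add_divide_distrib diff_divide_distrib)
qed

lemma tri_affine_T1 [simp]: "tri_affine T1 x = x"
proof -
  have "x $ 2 / sqrt 3 * sqrt 3 = x $ 2" by simp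
  then show ?thesis
    by (simp add: T1_def tri_affine_Tri vec_eq_iff forall_2 P1_eq_0 P2_def P3_def bary2_def bary3_def)
qed

lemma bary_eqI: "bary2 x = bary2 y \<Longrightarrow> bary3 x = bary3 y \<Longrightarrow> x = y"
  using tri_affine_T1[of x] tri_affine_T1[of y] by (simp add: tri_affine_def bary1_def)

lemma bary_bary_T1:
  assumes "a1 + a2 + a3 = 1"
  shows "bary1 (bary T1 (a1, a2, a3)) = a1" "bary2 (bary T1 (a1, a2, a3)) = a2" "bary3 (bary T1 (a1, a2, a3)) = a3"
  using assms by (simp_all add: T1_def bary_affine)

lemma bary_lipschitz: "\<bar>bary2 x - bary2 y\<bar> \<le> 2 * dist x y" "\<bar>bary3 x - bary3 y\<bar> \<le> 2 * dist x y"
proof -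
  define u where "u = x - y"
  have u: "\<bar>u $ 1\<bar> \<le> dist x y" "\<bar>u $ 2\<bar> \<le> dist x y"
    unfolding u_def dist_norm by (rule component_le_norm_cart)+
  have "\<bar>u $ 2 / sqrt 3\<bar> \<le> \<bar>u $ 2\<bar>"
    using divide_left_mono[of 1 "sqrt 3" "\<bar>u $ 2\<bar>"] by simp
  moreover have "bary2 x - bary2 y = u $ 1 - u $ 2 / sqrt 3" "bary3 x - bary3 y = 2 * (u $ 2 / sqrt 3)"
    by (simp_all add: bary2_def bary3_def u_def algebra_simps diff_divide_distrib)
  ultimately show "\<bar>bary2 x - bary2 y\<bar> \<le> 2 * dist x y" "\<bar>bary3 x - bary3 y\<bar> \<le> 2 * dist x y"
    using u by linarith+
qed

section \<open>Triangles and their maps in barycentric coordinates\<close>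

lemma region_eq: "region D = bary D ` H"
proof (cases D)
  case (Tri A1 A2 A3)
  show ?thesis unfolding Tri region.simps convex_hull_3 H_def
  proof (intro set_eqI iffI)
    fix x assume "x \<in> {u *\<^sub>R A1 + v *\<^sub>R A2 + w *\<^sub>R A3 |u v w. 0 \<le> u \<and> 0 \<le> v \<and> 0 \<le> w \<and> u + v + w = 1}"
    then obtain u v w where "x = bary (Tri A1 A2 A3) (u, v, w)" "0 \<le> u" "0 \<le> v" "0 \<le> w" "u + v + w = 1"
      by auto
    then show "x \<in> bary (Tri A1 A2 A3) ` {(a1, a2, a3). a1 \<in> {0..1} \<and> a2 \<in> {0..1} \<and> a3 \<in> {0..1} \<and> a1 + a2 + a3 = 1}"
      by (intro image_eqI[of _ _ "(u, v, w)"]) auto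
  qed (auto 4 4)
qed

lemma region_T1: "region T1 = {x. 0 \<le> bary1 x \<and> 0 \<le> bary2 x \<and> 0 \<le> bary3 x}"
proof (intro set_eqI iffI)
  fix x assume "x \<in> region T1"
  then obtain a1 a2 a3 where "x = bary T1 (a1, a2, a3)" "(a1, a2, a3) \<in> H"
    unfolding region_eq by auto
  then show "x \<in> {x. 0 \<le> bary1 x \<and> 0 \<le> bary2 x \<and> 0 \<le> bary3 x}" by (auto simp: H_def bary_bary_T1)
next
  fix x assume x: "x \<in> {x. 0 \<le> bary1 x \<and> 0 \<le> bary2 x \<and> 0 \<le> bary3 x}"
  then have "(bary1 x, bary2 x, bary3 x) \<in> H" using bary_sum[of x] by (auto simp: H_def)
  then show "x \<in> region T1" unfolding region_eq using tri_affine_T1[of x] by (metis tri_affine_def imageI)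
qed

lemma bary_in_H_iff: "(bary1 x, bary2 x, bary3 x) \<in> H \<longleftrightarrow> x \<in> region T1"
  using bary_sum[of x] by (auto simp: H_def region_T1)

lemma H_bary_T1: "a \<in> H \<Longrightarrow> bary T1 a \<in> region T1 \<and> (bary1 (bary T1 a), bary2 (bary T1 a), bary3 (bary T1 a)) = a"
  by (cases a) (auto simp: region_eq H_def bary_bary_T1)

lemma tri_map_eq: "x \<in> region T1 \<Longrightarrow> tri_map D x = tri_affine D x"
  unfolding tri_map_def
proof (rule the_equality)
  assume "x \<in> region T1"
  then show "\<exists>a\<in>H. x = bary T1 a \<and> tri_affine D x = bary D a"
    using bary_in_H_iff tri_affine_T1[of x] by (auto simp: tri_affine_def intro!: bexI[of _ "(bary1 x, bary2 x, bary3 x)"])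
next
  fix y assume "\<exists>a\<in>H. x = bary T1 a \<and> y = bary D a"
  then show "y = tri_affine D x" using H_bary_T1 by (metis tri_affine_def)
qed

lemma tri_map_image_eq: "X \<subseteq> region T1 \<Longrightarrow> tri_map D ` X = tri_affine D ` X"
  by (intro image_cong) (auto simp: tri_map_eq)

lemma tri_affine_image_T1: "tri_affine D ` region T1 = region D"
proof -
  have "tri_affine D ` region T1 = bary D ` ((\<lambda>x. (bary1 x, bary2 x, bary3 x)) ` region T1)"
    by (simp add: image_image tri_affine_def)
  also have "(\<lambda>x. (bary1 x, bary2 x, bary3 x)) ` region T1 = H"
  proof (intro set_eqI iffI)
    fix a assume "a \<in> H"
    then show "a \<in> (\<lambda>x. (bary1 x, bary2 x, bary3 x)) ` region T1"
      using H_bary_T1[of a] by (intro image_eqI[of _ _ "bary T1 a"]) auto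
  qed (auto simp: bary_in_H_iff)
  finally show ?thesis by (simp add: region_eq)
qed

text \<open>The inclusion puts the vertices of \<open>V\<close> where \<open>tri_map U\<close>
  agrees with its affine extension; affine maps preserve affine combinations, which gives the
  rest.\<close>

lemma tri_affine_tri_image:
  assumes "region V \<subseteq> region T1"
  shows "tri_affine (tri_image U V) x = tri_affine U (tri_affine V x)"
proof (cases U; cases V)
  fix A1 A2 A3 B1 B2 B3 assume U: "U = Tri A1 A2 A3" and V: "V = Tri B1 B2 B3"
  have "{B1, B2, B3} \<subseteq> region T1"
    using assms hull_subset[of "{B1, B2, B3}" convex] by (auto simp: V)
  then have "tri_map U B1 = tri_affine U B1" "tri_map U B2 = tri_affine U B2" "tri_map U B3 = tri_affine U B3"
    by (auto intro: tri_map_eq)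
  then show ?thesis
    by (simp add: U V tri_affine_Tri bary_affine[OF bary_sum] scaleR_add_left scaleR_add_right)
qed

text \<open>The triangle is an intersection of three half-planes whose normals are the gradients of
  the coordinates; these are nonzero, and interiors commute with finite intersections.\<close>

lemma interior_T1: "interior (region T1) = {x. 0 < bary1 x \<and> 0 < bary2 x \<and> 0 < bary3 x}"
proof -
  define n1 n2 n3 :: point
    where "n1 = vector [-1, - 1 / sqrt 3]" and "n2 = vector [1, - 1 / sqrt 3]" and "n3 = vector [0, 2 / sqrt 3]"
  have nz: "n1 \<noteq> 0" "n2 \<noteq> 0" "n3 \<noteq> 0"
    by (auto simp: n1_def n2_def n3_def vec_eq_iff forall_2)
  have eq: "bary1 x = n1 \<bullet> x + 1" "bary2 x = n2 \<bullet> x" "bary3 x = n3 \<bullet> x" for x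
    by (auto simp: n1_def n2_def n3_def bary1_def bary2_def bary3_def inner_vec_def sum_2 field_simps)
  have "region T1 = {x. n1 \<bullet> x \<ge> -1} \<inter> {x. n2 \<bullet> x \<ge> 0} \<inter> {x. n3 \<bullet> x \<ge> 0}"
    unfolding region_T1 eq by auto
  then show ?thesis using nz by (auto simp: eq)
qed

lemma compact_T1: "compact (region T1)"
  by (simp add: T1_def finite_imp_compact_convex_hull)

lemma diameter_T1: "diameter (region T1) \<le> 2"
proof -
  have "norm P2 \<le> 1" by (simp add: P2_def norm_vec_def L2_set_def sum_2)
  moreover have "norm P3 \<le> 1" by (simp add: P3_def norm_vec_def L2_set_def sum_2 power_divide)
  ultimately have "region T1 \<subseteq> cball 0 1"
    unfolding T1_def region.simps by (intro hull_minimal) (auto simp: P1_eq_0)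
  then show ?thesis
    by (metis bounded_cball diameter_cball diameter_subset mult.right_neutral not_one_less_zero)
qed

section \<open>The subdivision into triangles of side 1/m\<close>

text \<open>The index sum m - 1 makes the shifted coordinates add up to 1, so they are the
  barycentric coordinates of the image.\<close>

lemma tri_up_props:
  assumes "D = tri_up m k1 k2 k3" "k1 + k2 + k3 = int m - 1" "0 < m"
  shows "bary1 (tri_affine D x) = (real_of_int k1 + bary1 x) / m"
    "bary2 (tri_affine D x) = (real_of_int k2 + bary2 x) / m"
    "bary3 (tri_affine D x) = (real_of_int k3 + bary3 x) / m"
    "tri_affine D x = tri_affine D 0 + (1 / real m) *\<^sub>R x"
proof -
  have sum: "real_of_int k1 + k2 + k3 = real m - 1" using assms(2)
    by (metis of_int_1 of_int_add of_int_diff of_int_of_nat_eq)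
  define a where "a = ((real_of_int k1 + bary1 x) / m, (real_of_int k2 + bary2 x) / m, (real_of_int k3 + bary3 x) / m)"
  have one: "(real_of_int k1 + bary1 x) / m + (real_of_int k2 + bary2 x) / m + (real_of_int k3 + bary3 x) / m = 1"
  proof -
    have "(real_of_int k1 + bary1 x) + (real_of_int k2 + bary2 x) + (real_of_int k3 + bary3 x) = real m" using bary_sum[of x] sum by linarith
    then show ?thesis unfolding add_divide_distrib[symmetric] using assms(3) by simp
  qed
  define Q where "Q = of_int k1 *\<^sub>R P1 + of_int k2 *\<^sub>R P2 + of_int k3 *\<^sub>R P3"
  have D: "D = Tri ((1 / real m) *\<^sub>R (Q + P1)) ((1 / real m) *\<^sub>R (Q + P2)) ((1 / real m) *\<^sub>R (Q + P3))"
    by (simp add: assms(1) tri_up_def Q_def Let_def)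
  define q where "q = (1 / real m) *\<^sub>R Q"
  have *: "tri_affine D y = q + (1 / real m) *\<^sub>R y" for y
  proof -
    have "tri_affine D y = (bary1 y + bary2 y + bary3 y) *\<^sub>R q + (1 / real m) *\<^sub>R tri_affine T1 y"
      by (simp add: D T1_def tri_affine_Tri q_def algebra_simps)
    then show ?thesis by (simp add: bary_sum)
  qed
  have "tri_affine D x = q + (1 / real m) *\<^sub>R tri_affine T1 x" by (simp add: *)
  also have "\<dots> = bary T1 a"
    by (simp add: a_def T1_def tri_affine_Tri q_def Q_def algebra_simps add_divide_distrib)
  finally have "tri_affine D x = bary T1 a" .
  then show "bary1 (tri_affine D x) = (real_of_int k1 + bary1 x) / m"
    "bary2 (tri_affine D x) = (real_of_int k2 + bary2 x) / m"
    "bary3 (tri_affine D x) = (real_of_int k3 + bary3 x) / m"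
    by (simp_all only: a_def bary_bary_T1[OF one])
  show "tri_affine D x = tri_affine D 0 + (1 / real m) *\<^sub>R x" by (simp add: *)
qed

text \<open>Here the ratio is -1/m. The numerators add up to (m - 2) + 3 - 1 = m, which explains the
  index sum m - 2.\<close>

lemma tri_down_props:
  assumes "D = tri_down m k1 k2 k3" "k1 + k2 + k3 = int m - 2" "0 < m"
  shows "bary1 (tri_affine D x) = (real_of_int k1 + 1 - bary1 x) / m"
    "bary2 (tri_affine D x) = (real_of_int k2 + 1 - bary2 x) / m"
    "bary3 (tri_affine D x) = (real_of_int k3 + 1 - bary3 x) / m"
    "tri_affine D x = tri_affine D 0 + (- 1 / real m) *\<^sub>R x"
proof -
  have sum: "real_of_int k1 + k2 + k3 = real m - 2" using assms(2)
    by (metis of_int_numeral of_int_add of_int_diff of_int_of_nat_eq)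
  define a where "a = ((real_of_int k1 + 1 - bary1 x) / m, (real_of_int k2 + 1 - bary2 x) / m, (real_of_int k3 + 1 - bary3 x) / m)"
  have one: "(real_of_int k1 + 1 - bary1 x) / m + (real_of_int k2 + 1 - bary2 x) / m + (real_of_int k3 + 1 - bary3 x) / m = 1"
  proof -
    have "(real_of_int k1 + 1 - bary1 x) + (real_of_int k2 + 1 - bary2 x) + (real_of_int k3 + 1 - bary3 x) = real m" using bary_sum[of x] sum by linarith
    then show ?thesis unfolding add_divide_distrib[symmetric] using assms(3) by simp
  qed
  define Q where "Q = of_int k1 *\<^sub>R P1 + of_int k2 *\<^sub>R P2 + of_int k3 *\<^sub>R P3 + P1 + P2 + P3"
  have D: "D = Tri ((1 / real m) *\<^sub>R (Q - P1)) ((1 / real m) *\<^sub>R (Q - P2)) ((1 / real m) *\<^sub>R (Q - P3))"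
    by (simp add: assms(1) tri_down_def Q_def Let_def)
  define q where "q = (1 / real m) *\<^sub>R Q"
  have *: "tri_affine D y = q + (- 1 / real m) *\<^sub>R y" for y
  proof -
    have "tri_affine D y = (bary1 y + bary2 y + bary3 y) *\<^sub>R q + (- 1 / real m) *\<^sub>R tri_affine T1 y"
      by (simp add: D T1_def tri_affine_Tri q_def algebra_simps)
    then show ?thesis by (simp add: bary_sum)
  qed
  have "tri_affine D x = q + (- 1 / real m) *\<^sub>R tri_affine T1 x" by (simp add: *)
  also have "\<dots> = bary T1 a"
    by (simp add: a_def T1_def tri_affine_Tri q_def Q_def algebra_simps add_divide_distrib diff_divide_distrib)
  finally have "tri_affine D x = bary T1 a" .
  then show "bary1 (tri_affine D x) = (real_of_int k1 + 1 - bary1 x) / m"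
    "bary2 (tri_affine D x) = (real_of_int k2 + 1 - bary2 x) / m"
    "bary3 (tri_affine D x) = (real_of_int k3 + 1 - bary3 x) / m"
    by (simp_all only: a_def bary_bary_T1[OF one])
  show "tri_affine D x = tri_affine D 0 + (- 1 / real m) *\<^sub>R x" by (simp add: *)
qed

lemma tri_cases:
  assumes "D \<in> tri_ups m \<union> tri_downs m" "0 < m"
  obtains (up) k1 k2 k3 where "D = tri_up m k1 k2 k3" "k1 + k2 + k3 = int m - 1" "0 \<le> k1" "0 \<le> k2" "0 \<le> k3"
    "\<And>x. bary1 (tri_affine D x) = (real_of_int k1 + bary1 x) / m"
      "\<And>x. bary2 (tri_affine D x) = (real_of_int k2 + bary2 x) / m"
      "\<And>x. bary3 (tri_affine D x) = (real_of_int k3 + bary3 x) / m"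
  | (down) k1 k2 k3 where "D = tri_down m k1 k2 k3" "k1 + k2 + k3 = int m - 2" "0 \<le> k1" "0 \<le> k2" "0 \<le> k3"
    "\<And>x. bary1 (tri_affine D x) = (real_of_int k1 + 1 - bary1 x) / m"
      "\<And>x. bary2 (tri_affine D x) = (real_of_int k2 + 1 - bary2 x) / m"
      "\<And>x. bary3 (tri_affine D x) = (real_of_int k3 + 1 - bary3 x) / m"
proof -
  from assms(1) consider
    k1 k2 k3 where "D = tri_up m k1 k2 k3" "k1 + k2 + k3 = int m - 1" "0 \<le> k1" "0 \<le> k2" "0 \<le> k3"
  | k1 k2 k3 where "D = tri_down m k1 k2 k3" "k1 + k2 + k3 = int m - 2" "0 \<le> k1" "0 \<le> k2" "0 \<le> k3"
    by (auto simp: tri_ups_def tri_downs_def)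
  then show ?thesis
  proof cases
    case 1 then show ?thesis using up tri_up_props[OF 1(1,2) assms(2)] by blast
  next
    case 2 then show ?thesis using down tri_down_props[OF 2(1,2) assms(2)] by blast
  qed
qed

section \<open>The cell maps as similarities of ratio 1/m\<close>

lemma tri_affine_similarity:
  assumes "D \<in> tri_ups m \<union> tri_downs m" "0 < m"
  obtains c where "\<bar>c\<bar> = 1 / real m" "\<And>x. tri_affine D x = tri_affine D 0 + c *\<^sub>R x"
  using assms(1)
proof
  assume "D \<in> tri_ups m"
  then obtain k1 k2 k3 where "D = tri_up m k1 k2 k3" "k1 + k2 + k3 = int m - 1"
    by (auto simp: tri_ups_def)
  then have "tri_affine D x = tri_affine D 0 + (1 / real m) *\<^sub>R x" for x by (rule tri_up_props(4)[OF _ _ assms(2)])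
  then show ?thesis by (rule that[rotated]) simp
next
  assume "D \<in> tri_downs m"
  then obtain k1 k2 k3 where "D = tri_down m k1 k2 k3" "k1 + k2 + k3 = int m - 2"
    by (auto simp: tri_downs_def)
  then have "tri_affine D x = tri_affine D 0 + (- 1 / real m) *\<^sub>R x" for x by (rule tri_down_props(4)[OF _ _ assms(2)])
  then show ?thesis by (rule that[rotated]) simp
qed

lemma dist_tri_affine:
  assumes "D \<in> tri_ups m \<union> tri_downs m" "0 < m"
  shows "dist (tri_affine D x) (tri_affine D y) = 1 / real m * dist x y"
proof -
  obtain c where c: "\<bar>c\<bar> = 1 / real m" "\<And>x. tri_affine D x = tri_affine D 0 + c *\<^sub>R x"
    using tri_affine_similarity[OF assms] by blast
  have "tri_affine D x - tri_affine D y = c *\<^sub>R (x - y)" 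
  proof -
    have "tri_affine D x - tri_affine D y = (tri_affine D 0 + c *\<^sub>R x) - (tri_affine D 0 + c *\<^sub>R y)"
      by (rule arg_cong2[where f = "(-)"]) (rule c(2))+
    then show ?thesis by (simp add: algebra_simps)
  qed
  then show ?thesis by (simp add: dist_norm c(1))
qed

lemma interior_tri_affine_image:
  assumes "D \<in> tri_ups m \<union> tri_downs m" "0 < m"
  shows "interior (tri_affine D ` S) = tri_affine D ` interior S"
proof -
  obtain c where c: "\<bar>c\<bar> = 1 / real m" "\<And>x. tri_affine D x = tri_affine D 0 + c *\<^sub>R x"
    using tri_affine_similarity[OF assms] by blast
  have "c \<noteq> 0" using c(1) assms(2) by auto
  have "tri_affine D ` X = (+) (tri_affine D 0) ` (*\<^sub>R) c ` X" for X
    unfolding image_image by (intro image_cong refl c(2))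
  moreover have "interior ((*\<^sub>R) c ` S) = (*\<^sub>R) c ` interior S"
    using \<open>c \<noteq> 0\<close> by (intro interior_injective_linear_image) (auto simp: inj_on_def)
  ultimately show ?thesis by (simp add: interior_translation)
qed

lemma tri_affine_T1_subset:
  assumes "D \<in> tri_ups m \<union> tri_downs m" "0 < m"
  shows "tri_affine D ` region T1 \<subseteq> region T1"
proof clarify
  fix x assume x: "x \<in> region T1"
  then have "bary1 x \<le> 1" "bary2 x \<le> 1" "bary3 x \<le> 1" using bary_sum[of x] by (auto simp: region_T1)
  then show "tri_affine D x \<in> region T1" using x
    by (cases rule: tri_cases[OF assms]) (auto simp: region_T1)
qed

text \<open>An interior point of a cell determines the cell: the integer parts of \<open>m\<close> times its
  barycentric coordinates are the indices, and their sum tells the two orientations apart.\<close>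

definition floor1 :: "nat \<Rightarrow> point \<Rightarrow> int" where "floor1 m x = \<lfloor>m * bary1 x\<rfloor>"
definition floor2 :: "nat \<Rightarrow> point \<Rightarrow> int" where "floor2 m x = \<lfloor>m * bary2 x\<rfloor>"
definition floor3 :: "nat \<Rightarrow> point \<Rightarrow> int" where "floor3 m x = \<lfloor>m * bary3 x\<rfloor>"

lemma interior_T1_bounds:
  assumes "x \<in> interior (region T1)"
  shows "0 < bary1 x" "0 < bary2 x" "0 < bary3 x" "bary1 x < 1" "bary2 x < 1" "bary3 x < 1"
  using assms bary_sum[of x] by (auto simp: interior_T1)

lemma tri_up_floor:
  assumes D: "D \<in> tri_ups m" and m: "0 < m" and x: "x \<in> interior (region T1)"
  shows "D = tri_up m (floor1 m (tri_affine D x)) (floor2 m (tri_affine D x)) (floor3 m (tri_affine D x))"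
    and "floor1 m (tri_affine D x) + floor2 m (tri_affine D x) + floor3 m (tri_affine D x) = int m - 1"
proof -
  obtain k1 k2 k3 where k: "D = tri_up m k1 k2 k3" "k1 + k2 + k3 = int m - 1"
    using D by (auto simp: tri_ups_def)
  have fl: "\<lfloor>real_of_int k + t\<rfloor> = k" if "0 < t" "t < 1" for k t
    using that by (simp add: floor_eq_iff)
  have "floor1 m (tri_affine D x) = k1" "floor2 m (tri_affine D x) = k2" "floor3 m (tri_affine D x) = k3"
    using interior_T1_bounds[OF x] fl m by (simp_all add: tri_up_props(1-3)[OF k m] floor1_def floor2_def floor3_def)
  then show "D = tri_up m (floor1 m (tri_affine D x)) (floor2 m (tri_affine D x)) (floor3 m (tri_affine D x))"
    "floor1 m (tri_affine D x) + floor2 m (tri_affine D x) + floor3 m (tri_affine D x) = int m - 1"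
    using k by simp_all
qed

lemma tri_down_floor:
  assumes D: "D \<in> tri_downs m" and m: "0 < m" and x: "x \<in> interior (region T1)"
  shows "D = tri_down m (floor1 m (tri_affine D x)) (floor2 m (tri_affine D x)) (floor3 m (tri_affine D x))"
    and "floor1 m (tri_affine D x) + floor2 m (tri_affine D x) + floor3 m (tri_affine D x) = int m - 2"
proof -
  obtain k1 k2 k3 where k: "D = tri_down m k1 k2 k3" "k1 + k2 + k3 = int m - 2"
    using D by (auto simp: tri_downs_def)
  have fl: "\<lfloor>real_of_int k + 1 - t\<rfloor> = k" if "0 < t" "t < 1" for k t
    using that by (simp add: floor_eq_iff)
  have "floor1 m (tri_affine D x) = k1" "floor2 m (tri_affine D x) = k2" "floor3 m (tri_affine D x) = k3"
    using interior_T1_bounds[OF x] fl m by (simp_all add: tri_down_props(1-3)[OF k m] floor1_def floor2_def floor3_def)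
  then show "D = tri_down m (floor1 m (tri_affine D x)) (floor2 m (tri_affine D x)) (floor3 m (tri_affine D x))"
    "floor1 m (tri_affine D x) + floor2 m (tri_affine D x) + floor3 m (tri_affine D x) = int m - 2"
    using k by simp_all
qed

lemma tri_affine_eq_imp_eq:
  assumes D: "D \<in> tri_ups m \<union> tri_downs m" and D': "D' \<in> tri_ups m \<union> tri_downs m" and m: "0 < m"
    and x: "x \<in> interior (region T1)" and y: "y \<in> interior (region T1)" and eq: "tri_affine D x = tri_affine D' y"
  shows "D = D'"
proof -
  consider "D \<in> tri_ups m" "D' \<in> tri_ups m" | "D \<in> tri_downs m" "D' \<in> tri_downs m"
    | "D \<in> tri_ups m" "D' \<in> tri_downs m" | "D \<in> tri_downs m" "D' \<in> tri_ups m"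
    using D D' by blast
  then show ?thesis
  proof cases
    case 1 then show ?thesis using tri_up_floor(1)[OF _ m] x y eq by metis
  next
    case 2 then show ?thesis using tri_down_floor(1)[OF _ m] x y eq by metis
  next
    case 3
    then show ?thesis using tri_up_floor(2)[OF _ m x, of D] tri_down_floor(2)[OF _ m y, of D'] eq by simp
  next
    case 4
    then show ?thesis using tri_up_floor(2)[OF _ m y, of D'] tri_down_floor(2)[OF _ m x, of D] eq by simp
  qed
qed

lemma interior_T1_nonempty: "bary T1 (1/3, 1/3, 1/3) \<in> interior (region T1)"
  by (simp add: interior_T1 bary_bary_T1)

text \<open>At the image of the centroid the floors would add up to both m - 1 and m - 2.\<close>

lemma tri_ups_Int_downs:
  assumes "0 < m"
  shows "tri_ups m \<inter> tri_downs m = {}"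
proof -
  have "False" if "D \<in> tri_ups m" "D \<in> tri_downs m" for D
    using tri_up_floor(2)[OF that(1) assms interior_T1_nonempty]
      tri_down_floor(2)[OF that(2) assms interior_T1_nonempty] by simp
  then show ?thesis by blast
qed

lemma finite_tri_ups: "finite (tri_ups m)"
proof (rule finite_subset)
  show "tri_ups m \<subseteq> (\<lambda>(k1, k2, k3). tri_up m k1 k2 k3) ` ({0..int m} \<times> {0..int m} \<times> {0..int m})"
  proof
    fix D assume "D \<in> tri_ups m"
    then obtain k1 k2 k3 where "D = tri_up m k1 k2 k3" "0 \<le> k1" "0 \<le> k2" "0 \<le> k3" "k1 + k2 + k3 = int m - 1"
      by (auto simp: tri_ups_def)
    then show "D \<in> (\<lambda>(k1, k2, k3). tri_up m k1 k2 k3) ` ({0..int m} \<times> {0..int m} \<times> {0..int m})"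
      by (intro image_eqI[of _ _ "(k1, k2, k3)"]) auto
  qed
qed auto

lemma finite_tri_downs: "finite (tri_downs m)"
proof (rule finite_subset)
  show "tri_downs m \<subseteq> (\<lambda>(k1, k2, k3). tri_down m k1 k2 k3) ` ({0..int m} \<times> {0..int m} \<times> {0..int m})"
  proof
    fix D assume "D \<in> tri_downs m"
    then obtain k1 k2 k3 where "D = tri_down m k1 k2 k3" "0 \<le> k1" "0 \<le> k2" "0 \<le> k3" "k1 + k2 + k3 = int m - 2"
      by (auto simp: tri_downs_def)
    then show "D \<in> (\<lambda>(k1, k2, k3). tri_down m k1 k2 k3) ` ({0..int m} \<times> {0..int m} \<times> {0..int m})"
      by (intro image_eqI[of _ _ "(k1, k2, k3)"]) auto
  qed
qed auto

section \<open>Lattice points as markers\<close>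

text \<open>The centres of all cells of level \<open>k\<close> are among these points.\<close>

definition markers :: "nat \<Rightarrow> nat \<Rightarrow> point set" where
  "markers m k = {x \<in> interior (region T1). real (3 * m ^ k) * bary2 x \<in> \<int> \<and> real (3 * m ^ k) * bary3 x \<in> \<int>}"

text \<open>A point of \<open>S\<close> is determined by two integers, each confined to a window of
  2n + 3 values; one extra value at either end absorbs the rounding of the window's centre.\<close>

lemma card_lattice_le:
  fixes c :: real
  assumes "0 < c" "c * d \<le> real n"
    and S: "\<And>x. x \<in> S \<Longrightarrow> c * bary2 x \<in> \<int> \<and> c * bary3 x \<in> \<int> \<and> \<bar>bary2 x - p\<bar> \<le> d \<and> \<bar>bary3 x - q\<bar> \<le> d"
  shows "finite S \<and> card S \<le> (2 * n + 3)\<^sup>2"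
proof -
  define I where "I t = {\<lfloor>c * t\<rfloor> - int n - 1..\<lfloor>c * t\<rfloor> + int n + 1}" for t
  define g where "g x = (\<lfloor>c * bary2 x\<rfloor>, \<lfloor>c * bary3 x\<rfloor>)" for x
  have I: "\<lfloor>c * s\<rfloor> \<in> I t" if "\<bar>s - t\<bar> \<le> d" for s t
  proof -
    have "\<bar>c * s - c * t\<bar> = c * \<bar>s - t\<bar>"
      using assms(1) by (simp add: abs_mult flip: right_diff_distrib)
    also have "\<dots> \<le> c * d" using that assms(1) by simp
    finally have "\<bar>c * s - c * t\<bar> \<le> real n" using assms(2) by linarith
    then show ?thesis unfolding I_def atLeastAtMost_iff by linarith
  qed
  have floor_Ints: "real_of_int \<lfloor>t\<rfloor> = t" if "t \<in> \<int>" for t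
    using that by (auto elim: Ints_cases)
  have inj: "inj_on g S"
  proof (rule inj_onI)
    fix x y assume xy: "x \<in> S" "y \<in> S" "g x = g y"
    have "c * bary2 x = c * bary2 y" "c * bary3 x = c * bary3 y"
      using xy(3) S[OF xy(1)] S[OF xy(2)] floor_Ints unfolding g_def prod.inject by metis+
    then show "x = y" using assms(1) by (intro bary_eqI) auto
  qed
  have sub: "g ` S \<subseteq> I p \<times> I q" using S I by (auto simp: g_def)
  have fin: "finite (I p \<times> I q)" by (simp add: I_def)
  have "card (I t) = 2 * n + 3" for t
    unfolding I_def card_atLeastAtMost_int by linarith
  then have "card (I p \<times> I q) = (2 * n + 3)\<^sup>2"
    by (simp only: card_cartesian_product power2_eq_square)
  then show ?thesis
    using card_mono[OF fin sub] card_image[OF inj] finite_imageD[OF finite_subset[OF sub fin] inj] by simp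
qed

lemma finite_markers:
  assumes "0 < m"
  shows "finite (markers m k)"
proof -
  have "\<bar>bary2 x - 0\<bar> \<le> 1 \<and> \<bar>bary3 x - 0\<bar> \<le> 1" if "x \<in> markers m k" for x
    using interior_T1_bounds[of x] that by (auto simp: markers_def)
  then show ?thesis using assms
    by (intro card_lattice_le[of "real (3 * m ^ k)" 1 "3 * m ^ k" _ 0 0, THEN conjunct1]) (auto simp: markers_def)
qed

text \<open>The radius factor is at most 1 + 2 = 3, the Lipschitz constant 2 turns it into 6, and
  the lattice scale 3 m^k into n = 18. Hence 1521 = (2 * 18 + 3)^2.\<close>

lemma card_markers_cball:
  assumes "0 < m"
  shows "card (markers m k \<inter> cball y ((1 + diameter (region T1)) * (1 / real m) ^ k)) \<le> 1521"
proof -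
  define d where "d = 6 * (1 / real m) ^ k"
  have "\<bar>bary2 x - bary2 y\<bar> \<le> d \<and> \<bar>bary3 x - bary3 y\<bar> \<le> d"
    if "x \<in> cball y ((1 + diameter (region T1)) * (1 / real m) ^ k)" for x
  proof -
    have "dist x y \<le> (1 + diameter (region T1)) * (1 / real m) ^ k" using that by (simp add: dist_commute)
    also have "\<dots> \<le> 3 * (1 / real m) ^ k" using diameter_T1 by (intro mult_right_mono) auto
    finally show ?thesis using bary_lipschitz[of x y] unfolding d_def by linarith
  qed
  moreover have "real (3 * m ^ k) * d \<le> real 18" using assms by (simp add: d_def power_divide)
  ultimately show ?thesis using assms
    by (intro card_lattice_le[of "real (3 * m ^ k)" d 18 _ "bary2 y"
      "bary3 y", simplified, THEN conjunct2]) (auto simp: markers_def)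
qed

text \<open>A cell map shifts coordinates by integers, possibly changes their sign, and divides by
  m; only the last operation refines the lattice, by exactly one level.\<close>

lemma tri_affine_markers:
  assumes D: "D \<in> tri_ups m \<union> tri_downs m" and m: "0 < m"
  shows "tri_affine D ` markers m k \<subseteq> markers m (Suc k)"
proof clarify
  fix x assume x: "x \<in> markers m k"
  have "tri_affine D x \<in> interior (region T1)"
    using x interior_mono[OF tri_affine_T1_subset[OF D m]] by (auto simp: markers_def interior_tri_affine_image[OF D m])
  moreover have scale: "real (3 * m ^ Suc k) * (t / m) = real (3 * m ^ k) * t" for t
    using m by simp
  have "real (3 * m ^ k) * (real_of_int j + b) \<in> \<int>" "real (3 * m ^ k) * (real_of_int j + 1 - b) \<in> \<int>"
    if "real (3 * m ^ k) * b \<in> \<int>" for j b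
    using that unfolding distrib_left right_diff_distrib
    by (auto intro!: Ints_add Ints_diff Ints_mult simp del: of_nat_mult)
  with x have "real (3 * m ^ Suc k) * bary2 (tri_affine D x) \<in> \<int> \<and> real (3 * m ^ Suc k) * bary3 (tri_affine D x) \<in> \<int>"
    by (cases rule: tri_cases[OF D m]) (auto simp only: scale markers_def mem_Collect_eq)
  ultimately show "tri_affine D x \<in> markers m (Suc k)" by (simp add: markers_def)
qed

section \<open>The labyrinth fractals as attractors\<close>

lemma ln_lam_div_ln_m:
  assumes "1 < lam" "1 < m"
  shows "(1 / (1 / m)) powr (ln lam / ln m) = (lam::real)" "0 < ln lam / ln m"
  using assms by (simp_all add: powr_def)

lemma tri_affine_tri_images:
  assumes "\<And>V. V \<in> B \<Longrightarrow> region V \<subseteq> region T1"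
  shows "(\<Union>D\<in>tri_images A B. tri_affine D ` X) = (\<Union>U\<in>A. \<Union>V\<in>B. tri_affine U ` tri_affine V ` X)"
proof -
  have *: "tri_affine (tri_image U V) ` X = tri_affine U ` tri_affine V ` X" if "V \<in> B" for U V
    unfolding image_image by (intro image_cong refl tri_affine_tri_image assms that)
  have "(\<Union>D\<in>tri_images A B. tri_affine D ` X) = (\<Union>U\<in>A. \<Union>V\<in>B. tri_affine (tri_image U V) ` X)"
    by (auto simp: tri_images_def)
  then show ?thesis by (simp add: *)
qed

locale labyrinth_cells =
  fixes m :: nat and W W' Y Y' :: "triangle set"
  assumes m_ge_2: "2 \<le> m" and system: "patterns_system m W W' Y Y'"
    and nonempty: "W \<noteq> {}" "W' \<noteq> {}" "Y \<noteq> {}" "Y' \<noteq> {}"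
begin

abbreviation "G \<equiv> labyrinth_digraph W W' Y Y'"

abbreviation "cells \<equiv> tri_ups m \<union> tri_downs m"

definition arc_map :: "colour \<times> triangle \<times> colour \<Rightarrow> point \<Rightarrow> point" where
  "arc_map e = tri_affine (fst (snd e))"

definition lam :: real where
  "lam = (real (card W) + real (card Y) +
     sqrt ((real (card W) - real (card Y))\<^sup>2 + 4 * real (card W') * real (card Y'))) / 2"

text \<open>The Perron eigenvector of the matrix with rows \<open>(card W, card W')\<close> and
  \<open>(card Y', card Y)\<close>.\<close>

definition weight :: "colour \<Rightarrow> real" where
  "weight = case_colour (real (card W')) (lam - real (card W))"

lemma m_pos: "0 < m"
  using m_ge_2 by simp

lemma subsets: "W \<subseteq> tri_ups m" "Y \<subseteq> tri_ups m" "W' \<subseteq> tri_downs m" "Y' \<subseteq> tri_downs m"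
  using system by (auto simp: patterns_system_def)

lemma finites: "finite W" "finite Y" "finite W'" "finite Y'"
  using subsets finite_tri_ups finite_tri_downs finite_subset by metis+

lemma out_arcs_eq:
  "out_arcs G Omega = {Omega} \<times> W \<times> {Omega} \<union> {Omega} \<times> W' \<times> {Gamma}"
  "out_arcs G Gamma = {Gamma} \<times> Y \<times> {Gamma} \<union> {Gamma} \<times> Y' \<times> {Omega}"
  by (auto simp: labyrinth_digraph_def out_arcs_def)

lemma head_eq: "head G = snd \<circ> snd"
  by (simp add: labyrinth_digraph_def)

lemma arc_cell: "e \<in> out_arcs G v \<Longrightarrow> fst (snd e) \<in> cells"
  using subsets by (cases v) (auto simp: out_arcs_eq)

text \<open>The arcs leaving one vertex for different colours carry triangles of opposite
  orientation, which never coincide.\<close>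

lemma arc_eqI: "e \<in> out_arcs G v \<Longrightarrow> e' \<in> out_arcs G v \<Longrightarrow> fst (snd e) = fst (snd e') \<Longrightarrow> e = e'"
proof -
  have "W \<inter> W' = {}" "Y \<inter> Y' = {}" using subsets tri_ups_Int_downs[OF m_pos] by blast+
  then show "e \<in> out_arcs G v \<Longrightarrow> e' \<in> out_arcs G v \<Longrightarrow> fst (snd e) = fst (snd e') \<Longrightarrow> e = e'"
    by (cases v) (auto simp: out_arcs_eq)
qed

lemma disjoint_interiors:
  assumes "e \<in> out_arcs G v" "e' \<in> out_arcs G v" "e \<noteq> e'"
  shows "arc_map e ` interior (region T1) \<inter> arc_map e' ` interior (region T1) = {}"
proof -
  have False if "x \<in> interior (region T1)" "y \<in> interior (region T1)" "arc_map e x = arc_map e' y" for x y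
  proof -
    have "fst (snd e) = fst (snd e')"
      using that unfolding arc_map_def
      by (rule tri_affine_eq_imp_eq[OF arc_cell[OF assms(1)] arc_cell[OF assms(2)] m_pos])
    then show False using arc_eqI assms by blast
  qed
  then show ?thesis by (auto simp: image_iff)
qed

section \<open>The Perron root and positivity of its eigenvector\<close>

lemma card_pos: "0 < real (card W)" "0 < real (card Y)" "0 < real (card W')" "0 < real (card Y')"
  using nonempty finites by (simp_all add: card_gt_0_iff)

text \<open>The positive product under the root makes it exceed the absolute difference of the two
  cardinalities.\<close>

lemma lam_gt: "real (card W) < lam" "real (card Y) < lam"
proof -
  have "0 < 4 * real (card W') * real (card Y')" using card_pos by simp
  then have less: "\<bar>real (card W) - real (card Y)\<bar> <
      sqrt ((real (card W) - real (card Y))\<^sup>2 + 4 * real (card W') * real (card Y'))"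
    by (intro real_less_rsqrt) simp
  show "real (card W) < lam" using less unfolding lam_def by argo
  show "real (card Y) < lam" using less unfolding lam_def by argo
qed

lemma lam_gt_1: "1 < lam"
proof -
  have "1 \<le> real (card W)" using card_pos(1) by simp
  then show ?thesis using lam_gt(1) by linarith
qed

text \<open>The characteristic equation of the adjacency matrix.\<close>

lemma lam_quadratic: "(lam - real (card W)) * (lam - real (card Y)) = real (card W') * real (card Y')"
proof -
  define w y p where "w = real (card W)" and "y = real (card Y)" and "p = real (card W') * real (card Y')"
  define q where "q = sqrt ((w - y)\<^sup>2 + 4 * p)"
  have "q\<^sup>2 = (w - y)\<^sup>2 + 4 * p" unfolding q_def by (intro real_sqrt_pow2) (simp add: p_def)
  moreover have lam: "lam = (w + y + q) / 2" by (simp add: lam_def w_def y_def q_def p_def mult.assoc)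
  have "(lam - w) * (lam - y) = (q\<^sup>2 - (w - y)\<^sup>2) / 4"
    unfolding lam by (simp add: field_simps power2_eq_square)
  ultimately have "(lam - w) * (lam - y) = p" by simp
  then show ?thesis by (simp add: w_def y_def p_def)
qed

sublocale weighted_graph_similarities "out_arcs G" "head G" arc_map "region T1" "1 / real m" weight
  "Min (range weight)" "Max (range weight)" lam "ln lam / ln (real m)" "markers m" 1521
proof
  have UNIV: "(UNIV :: colour set) = {Omega, Gamma}" by (auto intro: colour.exhaust)
  have range: "range weight = {weight Omega, weight Gamma}" by (simp add: UNIV)
  have finite_range: "finite (range weight)" by (simp add: range)
  fix v :: colour
  show "finite (out_arcs G v)" using finites by (cases v) (auto simp: out_arcs_eq)
  show "out_arcs G v \<noteq> {}" using nonempty by (cases v) (auto simp: out_arcs_eq)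
  show "compact (region T1)" by (rule compact_T1)
  show "region T1 \<noteq> {}" using interior_T1_nonempty interior_subset by blast
  show "0 < 1 / real m" "1 / real m < 1" using m_ge_2 by simp_all
  show "weight v \<le> Max (range weight)" "Min (range weight) \<le> weight v"
    using finite_range by (auto intro: Max_ge Min_le)
  show "0 < Min (range weight)" unfolding range using lam_gt card_pos by (simp add: weight_def)
  show "lam = (1 / (1 / real m)) powr (ln lam / ln (real m))" "0 < ln lam / ln (real m)"
    using ln_lam_div_ln_m[OF lam_gt_1, of "real m"] m_ge_2 by simp_all
  show "(\<Sum>e\<in>out_arcs G v. weight (head G e)) = lam * weight v"
  proof -
    have const: "(\<Sum>e\<in>{c} \<times> A \<times> {c'}. weight (head G e)) = real (card A) * weight c'" for c c' A
    proof -
      have "(\<Sum>e\<in>{c} \<times> A \<times> {c'}. weight (head G e)) = (\<Sum>e\<in>{c} \<times> A \<times> {c'}. weight c')"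
        by (intro sum.cong) (auto simp: head_eq)
      then show ?thesis by (simp add: card_cartesian_product)
    qed
    have "(\<Sum>e\<in>out_arcs G Omega. weight (head G e)) = real (card W) * weight Omega + real (card W') * weight Gamma"
      unfolding out_arcs_eq by (subst sum.union_disjoint) (auto simp: const finites)
    moreover have "(\<Sum>e\<in>out_arcs G Gamma. weight (head G e)) = real (card Y) * weight Gamma + real (card Y') * weight Omega"
      unfolding out_arcs_eq by (subst sum.union_disjoint) (auto simp: const finites)
    \<comment> \<open>At \<open>Omega\<close> the eigenvalue equation is an identity for this choice
      of weights; at \<open>Gamma\<close> it is the characteristic equation.\<close>
    ultimately show ?thesis using lam_quadratic
      by (cases v) (simp_all add: weight_def algebra_simps)
  qed
  fix k :: nat
  show "finite (markers m k)" by (rule finite_markers[OF m_pos])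
  have "bary T1 (1/3, 1/3, 1/3) \<in> markers m 0"
    using interior_T1_nonempty by (simp add: markers_def bary_bary_T1)
  then show "markers m 0 \<inter> region T1 \<noteq> {}"
    using interior_subset[of "region T1"] by (auto simp: markers_def)
  fix x show "card (markers m k \<inter> cball x ((1 + diameter (region T1)) * (1 / real m) ^ k)) \<le> 1521"
    by (rule card_markers_cball[OF m_pos])
  fix e assume e: "e \<in> out_arcs G v"
  show "arc_map e ` region T1 \<subseteq> region T1"
    unfolding arc_map_def by (rule tri_affine_T1_subset[OF arc_cell[OF e] m_pos])
  show "dist (arc_map e x) (arc_map e y) = 1 / real m * dist x y" for x y
    unfolding arc_map_def by (rule dist_tri_affine[OF arc_cell[OF e] m_pos])
  show "arc_map e ` markers m k \<subseteq> markers m (Suc k)"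
    unfolding arc_map_def by (rule tri_affine_markers[OF arc_cell[OF e] m_pos])
  fix e' assume "e' \<in> out_arcs G v" "e \<noteq> e'"
  then have "arc_map e ` interior (region T1) \<inter> arc_map e' ` interior (region T1) = {}"
    by (rule disjoint_interiors[OF e])
  moreover have "markers m k \<subseteq> interior (region T1)" by (auto simp: markers_def)
  ultimately show "arc_map e ` markers m k \<inter> arc_map e' ` markers m k = {}" by blast
qed

section \<open>The fractals as invariant sets\<close>

lemma step_eq:
  "step X Omega = (\<Union>D\<in>W. tri_affine D ` X Omega) \<union> (\<Union>D\<in>W'. tri_affine D ` X Gamma)"
  "step X Gamma = (\<Union>D\<in>Y. tri_affine D ` X Gamma) \<union> (\<Union>D\<in>Y'. tri_affine D ` X Omega)"
proof -
  have "(\<Union>e\<in>{c} \<times> A \<times> {c'}. arc_map e ` X (head G e)) = (\<Union>D\<in>A. tri_affine D ` X c')" for c c' A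
    by (simp add: head_eq arc_map_def Sigma_def)
  then show "step X Omega = (\<Union>D\<in>W. tri_affine D ` X Omega) \<union> (\<Union>D\<in>W'. tri_affine D ` X Gamma)"
    "step X Gamma = (\<Union>D\<in>Y. tri_affine D ` X Gamma) \<union> (\<Union>D\<in>Y'. tri_affine D ` X Omega)"
    unfolding step_def out_arcs_eq UN_Un by simp_all
qed

lemma regions_inside: "D \<in> W \<union> W' \<union> (Y \<union> Y') \<Longrightarrow> region D \<subseteq> region T1"
  using tri_affine_T1_subset[OF _ m_pos, of D] subsets by (auto simp: tri_affine_image_T1)

text \<open>The pattern recursion refines at the innermost level, whereas \<open>step\<close> acts at the
  outermost one, so the induction has to range over all families \<open>X\<close>.\<close>

lemma step_power_eq:
  "(step ^^ Suc n) X Omega = (\<Union>D\<in>white_up W W' Y Y' (Suc n). tri_affine D ` X Omega) \<union>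
     (\<Union>D\<in>white_down W W' Y Y' (Suc n). tri_affine D ` X Gamma) \<and>
   (step ^^ Suc n) X Gamma = (\<Union>D\<in>yellow_up W W' Y Y' (Suc n). tri_affine D ` X Gamma) \<union>
     (\<Union>D\<in>yellow_down W W' Y Y' (Suc n). tri_affine D ` X Omega)"
proof (induction n arbitrary: X)
  case 0 then show ?case by (simp add: step_eq)
next
  case (Suc n)
  have "(step ^^ Suc (Suc n)) X = (step ^^ Suc n) (step X)"
    by (simp only: funpow_Suc_right[of "Suc n"] comp_apply)
  moreover have
    "(\<Union>D\<in>tri_images A W. tri_affine D ` Z) = (\<Union>U\<in>A. \<Union>V\<in>W. tri_affine U ` tri_affine V ` Z)"
    "(\<Union>D\<in>tri_images A W'. tri_affine D ` Z) = (\<Union>U\<in>A. \<Union>V\<in>W'. tri_affine U ` tri_affine V ` Z)"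
    "(\<Union>D\<in>tri_images A Y. tri_affine D ` Z) = (\<Union>U\<in>A. \<Union>V\<in>Y. tri_affine U ` tri_affine V ` Z)"
    "(\<Union>D\<in>tri_images A Y'. tri_affine D ` Z) = (\<Union>U\<in>A. \<Union>V\<in>Y'. tri_affine U ` tri_affine V ` Z)" for A Z
    by (intro tri_affine_tri_images regions_inside; blast)+
  moreover have
    "tri_affine U ` step X Omega = (\<Union>V\<in>W. tri_affine U ` tri_affine V ` X Omega) \<union> (\<Union>V\<in>W'. tri_affine U ` tri_affine V ` X Gamma)"
    "tri_affine U ` step X Gamma = (\<Union>V\<in>Y. tri_affine U ` tri_affine V ` X Gamma) \<union> (\<Union>V\<in>Y'. tri_affine U ` tri_affine V ` X Omega)" for U
    by (simp_all only: step_eq image_Un image_UN)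
  ultimately show ?case
    by (simp only: Suc.IH white_up.simps white_down.simps yellow_up.simps yellow_down.simps
        UN_Un UN_Un_distrib Un_ac simp_thms)
qed

text \<open>Applied to the constant family \<open>region T1\<close>, the n-fold step yields the
  union of the level-n cells. The fractals start at level 1 and the attractor at level 0, which
  contains level 1.\<close>

lemma fractal_eq_attractor:
  "white_fractal W W' Y Y' = attractor Omega" "yellow_fractal W W' Y Y' = attractor Gamma"
proof -
  have eq: "attractor v = (\<Inter>n\<in>{1..}. approx n v)" for v
  proof
    show "(\<Inter>n\<in>{1..}. approx n v) \<subseteq> attractor v"
    proof
      fix x assume x: "x \<in> (\<Inter>n\<in>{1..}. approx n v)"
      have "x \<in> approx n v" for n using x approx_Suc_subset[of n v] by auto
      then show "x \<in> attractor v" by (simp add: attractor_def)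
    qed
  qed (auto simp: attractor_def)
  have "approx n Omega = (\<Union>D\<in>white_up W W' Y Y' n \<union> white_down W W' Y Y' n. region D) \<and>
    approx n Gamma = (\<Union>D\<in>yellow_up W W' Y Y' n \<union> yellow_down W W' Y Y' n. region D)"
    if "n \<in> {1..}" for n
  proof -
    have "n \<noteq> 0" using that by simp
    then obtain k where "n = Suc k" by (cases n) auto
    then show ?thesis unfolding approx_def by (simp only: step_power_eq tri_affine_image_T1 UN_Un)
  qed
  then show "white_fractal W W' Y Y' = attractor Omega" "yellow_fractal W W' Y Y' = attractor Gamma"
    unfolding white_fractal_def yellow_fractal_def eq by (intro INF_cong refl; blast)+
qed

lemma attractor_eq:
  "attractor Omega = (\<Union>D\<in>W. tri_map D ` attractor Omega) \<union> (\<Union>D\<in>W'. tri_map D ` attractor Gamma)"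
  "attractor Gamma = (\<Union>D\<in>Y. tri_map D ` attractor Gamma) \<union> (\<Union>D\<in>Y'. tri_map D ` attractor Omega)"
proof -
  have fixpoint: "step attractor v = attractor v" for v
    unfolding step_def by (rule attractor_unfold[symmetric])
  show "attractor Omega = (\<Union>D\<in>W. tri_map D ` attractor Omega) \<union> (\<Union>D\<in>W'. tri_map D ` attractor Gamma)"
    "attractor Gamma = (\<Union>D\<in>Y. tri_map D ` attractor Gamma) \<union> (\<Union>D\<in>Y'. tri_map D ` attractor Omega)"
    using step_eq[of attractor] unfolding fixpoint tri_map_image_eq[OF attractor_subset] .
qed

text \<open>Seed sets and invariant families lie in \<open>region T1\<close>, where
  \<open>tri_map\<close> and \<open>arc_map\<close> agree, so everything transfers from the affine
  system, including uniqueness for competing families.\<close>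

lemma graph_directed:
  "have_graph_directed_structure W W' Y Y' (attractor Omega) (attractor Gamma)"
proof -
  let ?f = "\<lambda>(_, D, _). tri_map D"
  have verts: "verts G = {Omega, Gamma}" by (simp add: labyrinth_digraph_def)
  have in_verts: "v \<in> verts G" for v by (cases v) (auto simp: verts)
  have tail: "e \<in> out_arcs G (tail G e)" if "e \<in> arcs G" for e using that by simp
  have f: "?f e x = arc_map e x" if "x \<in> region T1" for e x
    using that by (auto simp: arc_map_def tri_map_eq split: prod.splits)
  have f_image: "?f e ` X = arc_map e ` X" if "X \<subseteq> region T1" for e X
    by (intro image_cong refl f) (rule subsetD[OF that])
  have interior_eq: "interior (?f e ` region T1) = arc_map e ` interior (region T1)"
    if "e \<in> out_arcs G v" for e v
    unfolding f_image[OF order_refl] unfolding arc_map_def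
    by (rule interior_tri_affine_image[OF arc_cell[OF that] m_pos])
  have gd: "graph_directed_ifs G (\<lambda>_. region T1) ?f"
    unfolding graph_directed_ifs_def
  proof (intro conjI ballI impI)
    show "fin_digraph G"
      by unfold_locales (auto simp: labyrinth_digraph_def finites)
    show "compact (region T1)" by (rule compact_T1)
    show "interior (region T1) \<noteq> {}" using interior_T1_nonempty by blast
    fix v
    show "out_arcs G v \<noteq> {}" by (rule E_nonempty)
    fix e
    show "interior (?f e ` region T1) \<inter> interior (?f e' ` region T1) = {}"
      if "e \<in> out_arcs G v" "e' \<in> out_arcs G v" "e \<noteq> e'" for e'
      unfolding interior_eq[OF that(1)] interior_eq[OF that(2)] by (rule disjoint_interiors[OF that])
    assume "e \<in> arcs G"
    note e = tail[OF this]
    show "?f e ` region T1 \<subseteq> region T1"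
      unfolding f_image[OF order_refl] by (rule F_T[OF e])
    show "\<exists>r. 0 < r \<and> r < 1 \<and> (\<forall>x\<in>region T1. \<forall>y\<in>region T1. dist (?f e x) (?f e y) = r * dist x y)"
      using F_dist[OF e] r_pos r_less_1 by (intro exI[of _ "1 / real m"] conjI ballI) (simp_all only: f)
  qed
  have K: "case_colour (attractor Omega) (attractor Gamma) = attractor"
    by (auto split: colour.splits)
  have inv: "invariant_family G (\<lambda>_. region T1) ?f attractor"
    unfolding invariant_family_def f_image[OF attractor_subset]
  proof (intro ballI conjI)
    fix v
    show "compact (attractor v)" by (rule compact_attractor)
    show "attractor v \<noteq> {}" by (rule attractor_nonempty)
    show "attractor v \<subseteq> region T1" by (rule attractor_subset)
    show "attractor v = (\<Union>e\<in>out_arcs G v. arc_map e ` attractor (head G e))"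
      by (rule attractor_unfold)
  qed
  have "K' v = attractor v" if K': "invariant_family G (\<lambda>_. region T1) ?f K'" for K' v
  proof (rule attractor_unique)
    note K'_v = bspec[OF K'[unfolded invariant_family_def] in_verts]
    have sub: "K' v \<subseteq> region T1" for v using K'_v[of v] by (elim conjE)
    fix v
    show "compact (K' v)" using K'_v[of v] by (elim conjE)
    show "K' v \<noteq> {}" using K'_v[of v] by (elim conjE)
    show "K' v \<subseteq> region T1" by (rule sub)
    have "K' v = (\<Union>e\<in>out_arcs G v. ?f e ` K' (head G e))" using K'_v[of v] by (elim conjE)
    then show "K' v = (\<Union>e\<in>out_arcs G v. arc_map e ` K' (head G e))"
      unfolding f_image[OF sub] .
  qed
  then show ?thesis
    unfolding have_graph_directed_structure_def invariant_sets_of_def K using gd inv by blast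
qed

end

theorem proposition4p4:
  fixes m :: nat and W W' Y Y' :: "triangle set"
  defines "Lw \<equiv> white_fractal W W' Y Y'"
    and "Ly \<equiv> yellow_fractal W W' Y Y'"
    and "lam \<equiv> (real (card W) + real (card Y) +
           sqrt ((real (card W) - real (card Y))\<^sup>2 + 4 * real (card W') * real (card Y'))) / 2"
  assumes "2 \<le> m"
    and "labyrinth_patterns_system m W W' Y Y'"
    and "W' \<noteq> {}" and "Y' \<noteq> {}"
  shows "have_graph_directed_structure W W' Y Y' Lw Ly \<and>
    Lw = (\<Union>D\<in>W. tri_map D ` Lw) \<union> (\<Union>D\<in>W'. tri_map D ` Ly) \<and>
    Ly = (\<Union>D\<in>Y. tri_map D ` Ly) \<union> (\<Union>D\<in>Y'. tri_map D ` Lw) \<and>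
    hausdorff_dim Lw = ereal (ln lam / ln (real m)) \<and>
    hausdorff_dim Ly = ereal (ln lam / ln (real m)) \<and>
    has_box_dim Lw (ln lam / ln (real m)) \<and>
    has_box_dim Ly (ln lam / ln (real m))"
proof -
  \<comment> \<open>The triple in the exits property exhibits triangles of both sets.\<close>
  have "W \<noteq> {}" "Y \<noteq> {}"
    using assms(5) by (auto simp: labyrinth_patterns_system_def exits_property_def)
  then interpret labyrinth_cells m W W' Y Y'
    using assms by unfold_locales (auto simp: labyrinth_patterns_system_def)
  have "lam = labyrinth_cells.lam W W' Y Y'"
    unfolding assms(3) by (rule lam_def[symmetric])
  then show ?thesis
    unfolding assms(1,2) fractal_eq_attractor
    using graph_directed attractor_eq hausdorff_dim_attractor has_box_dim_attractor by simp
qed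

end
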